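(* Let $U$ be the open unit disc, $E\subset U$ a set containing infinitely many points whose closure $\overline E$ is contained in $U$, let $1\le p\le\infty$ and $R\in(0,1)$. Then there exists $\varepsilon_0>0$ such that for every $0<\varepsilon<\varepsilon_0$ there is a finite Blaschke product $B_\varepsilon(z)=\prod_{j=1}^n\frac{z-z_j}{1-\overline{z_j}z}$ whose zeros $z_1,\dots,z_n$ lie in $\overline E$, satisfying \[ \max_{|z|\le R}|B_\varepsilon(z)|\le C_p(\varepsilon,R)\le C\max_{|z|\le R}|B_\varepsilon(z)|^{1/2}, \] where $C>0$ is a constant depending only on $R$ and $p$, and moreover $\sup_{z\in E}|B_\varepsilon(z)|\le\varepsilon$.
   Context: $H^p=H^p(U)$ is the Hardy space of holomorphic $g$ on $U$ with $\|g\|_p<\infty$, where $\|g\|_p=\lim_{r\uparrow1}\left(\frac1{2\pi}\int_0^{2\pi}|g(re^{i\theta})|^pd\theta\right)^{1/p}$ for $1\le p<\infty$ and $\|g\|_\infty=\lim_{r\uparrow1}\sup_\theta|g(re^{i\theta})|$. For $\varepsilon>0$ and $R\in(0,1)$, \[ C_p(\varepsilon,R)=\sup\Big\{\sup_{|z|\le R}|g(z)| : g\in H^p,\ \|g\|_p\le1,\ |g(\zeta)|\le\varepsilon\ \forall \zeta\in E\Big\}. \] *)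

theory Defs
  imports "HOL-Analysis.Analysis"
begin

definition integral_mean :: "real \<Rightarrow> (complex \<Rightarrow> complex) \<Rightarrow> real \<Rightarrow> real" where
  "integral_mean p g r =
     (1 / (2 * pi) * integral {0..2*pi} (\<lambda>\<theta>. norm (g (of_real r * cis \<theta>)) powr p)) powr (1 / p)"

text \<open>Hardy norm; the exponent p ranges over [1, infinity] as an extended real.
  The value lives in ereal so that an infinite norm is possible.\<close>
definition hardy_norm :: "ereal \<Rightarrow> (complex \<Rightarrow> complex) \<Rightarrow> ereal" where
  "hardy_norm p g =
     (if p = \<infinity> then Lim (at_left 1) (\<lambda>r. ereal (SUP \<theta>\<in>UNIV. norm (g (of_real r * cis \<theta>))))
      else Lim (at_left 1) (\<lambda>r. ereal (integral_mean (real_of_ereal p) g r)))"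

definition hardy_space :: "ereal \<Rightarrow> (complex \<Rightarrow> complex) set" where
  "hardy_space p = {g. g holomorphic_on ball 0 1 \<and> hardy_norm p g < \<infinity>}"

definition C_const :: "ereal \<Rightarrow> complex set \<Rightarrow> real \<Rightarrow> real \<Rightarrow> real" where
  "C_const p E \<epsilon> R =
     (SUP g\<in>{g \<in> hardy_space p. hardy_norm p g \<le> 1 \<and> (\<forall>\<zeta>\<in>E. norm (g \<zeta>) \<le> \<epsilon>)}.
        (SUP z\<in>cball 0 R. norm (g z)))"

definition blaschke :: "complex list \<Rightarrow> complex \<Rightarrow> complex" where
  "blaschke zs z = (\<Prod>w\<leftarrow>zs. (z - w) / (1 - cnj w * z))"

end

theory Submission
  imports Defs "HOL-Complex_Analysis.Complex_Analysis"
begin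

text \<open>The zeros of \<open>B\<close> are those of a finite Blaschke product \<open>A\<close>, each taken twice: \<open>B = A\<^sup>2\<close>.
  The zero set \<open>F\<close> of \<open>A\<close> is a nearly optimal Fekete set for the pseudohyperbolic distance on \<open>E\<close>,
  of the least size \<open>n\<close> for which this forces \<open>\<bar>A\<bar>\<^sup>2 \<le> \<epsilon>\<close> on \<open>E\<close>. Minimality of \<open>n\<close> makes the product
  \<open>A\<^sub>w\<close> with the zero \<open>w\<close> omitted satisfy \<open>\<bar>A\<^sub>w w\<bar> \<ge> \<surd>\<epsilon> / 2\<close>. A competitor \<open>g\<close> then splits as
  \<open>g = L + A h\<close>, where \<open>L = \<Sum>\<^sub>w g w \<cdot> A\<^sub>w / A\<^sub>w w\<close> interpolates \<open>g\<close> on \<open>F\<close> and is at most \<open>2 n \<surd>\<epsilon>\<close> on the disc,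
  so \<open>h\<close> is bounded on \<open>\<bar>z\<bar> \<le> R\<close> by Cauchy's formula. A Bernstein--Walsh estimate bounds
  \<open>A\<^sub>w\<close> on \<open>\<bar>z\<bar> \<le> R\<close> by \<open>O(n)\<close> times the maximum of \<open>\<bar>A\<bar>\<close> there. Since \<open>n = O(log (1/\<epsilon>))\<close>, the factor
  \<open>n\<^sup>2 \<surd>\<epsilon>\<close> lost in \<open>L\<close> is harmless, and \<open>\<bar>g\<bar>\<close> is at most a constant times the maximum of \<open>\<bar>A\<bar> = \<bar>B\<bar>\<^bsup>1/2\<^esup>\<close>.\<close>

section \<open>Integral means and Hardy norms\<close>

lemma integral_periodic_shift:
  fixes f :: "real \<Rightarrow> 'a::banach"
  assumes cont: "continuous_on UNIV f" and per: "\<And>x. f (x + T) = f x" and a: "0 \<le> a" "a \<le> T"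
  shows "integral {0..T} (\<lambda>x. f (x + a)) = integral {0..T} f"
proof -
  have int: "f integrable_on {c..d}" for c d
    by (intro integrable_continuous_real continuous_on_subset[OF cont]) auto
  have "integral {0..T} (\<lambda>x. f (x + a)) = integral {a..T + a} f"
    using integral_shift_Icc_real[of 0 T f a] by (simp add: o_def add.commute)
  also have "\<dots> = integral {a..T} f + integral {T..T + a} f"
    using Henstock_Kurzweil_Integration.integral_combine[of a T "T + a" f] a int by simp
  also have "integral {T..T + a} f = integral {0..a} f"
    using integral_shift_Icc_real[of 0 a f T] per by (simp add: o_def add.commute)
  also have "integral {a..T} f + integral {0..a} f = integral {0..T} f"
    using Henstock_Kurzweil_Integration.integral_combine[of 0 a T f] a int by (simp add: add.commute)
  finally show ?thesis .
qed

lemma continuous_on_circle: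
  fixes g :: "complex \<Rightarrow> complex"
  assumes "continuous_on (ball 0 1) g" and "norm z < 1"
  shows "continuous_on A (\<lambda>\<theta>. g (z * cis \<theta>))"
  using assms by (intro continuous_on_compose2[OF assms(1)] continuous_intros) (auto simp: norm_mult)

lemma continuous_on_circle_powr:
  fixes g :: "complex \<Rightarrow> complex"
  assumes "continuous_on (ball 0 1) g" and "norm z < 1" and "0 < p"
  shows "continuous_on A (\<lambda>\<theta>. norm (g (z * cis \<theta>)) powr p)"
  using assms by (intro continuous_on_powr' continuous_intros continuous_on_circle) auto

text \<open>In the duality argument below the pairing is estimated at every \<open>z\<close> of a
  circle; rotation makes that estimate depend on \<open>norm z\<close> alone.\<close>

lemma circle_integral_rotate:
  fixes g :: "complex \<Rightarrow> complex"
  assumes "continuous_on (ball 0 1) g" and "norm z < 1" and "0 < p"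
  shows "integral {0..2*pi} (\<lambda>\<theta>. norm (g (z * cis \<theta>)) powr p)
       = integral {0..2*pi} (\<lambda>\<theta>. norm (g (of_real (norm z) * cis \<theta>)) powr p)"
proof -
  define f where "f \<theta> = norm (g (of_real (norm z) * cis \<theta>)) powr p" for \<theta>
  have z: "z = of_real (norm z) * cis (Arg2pi z)"
    using Arg2pi[of z] by (simp add: cis_conv_exp is_Arg_def)
  have "integral {0..2*pi} (\<lambda>\<theta>. f (\<theta> + Arg2pi z)) = integral {0..2*pi} f"
  proof (rule integral_periodic_shift)
    show "continuous_on UNIV f"
      unfolding f_def using assms by (intro continuous_on_circle_powr) auto
    show "f (x + 2*pi) = f x" for x
      by (simp add: f_def flip: cis_mult)
  qed (use Arg2pi[of z] in auto)
  moreover have "f (\<theta> + Arg2pi z) = norm (g (z * cis \<theta>)) powr p" for \<theta>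
    by (subst (2) z) (simp add: f_def cis_mult mult.assoc add.commute)
  ultimately show ?thesis
    by (simp add: f_def[abs_def])
qed

section \<open>Monotonicity of integral means in the radius\<close>

text \<open>Young's inequality for the exponents \<open>p\<close> and \<open>p / (p - 1)\<close>,
  arranged so that it also makes sense at \<open>p = 1\<close>. With \<open>v = 1\<close> it
  compares the first power with the \<open>p\<close>-th.\<close>

lemma mult_powr_le:
  fixes a v p :: real
  assumes "1 \<le> p" "0 \<le> a" "0 < v"
  shows "a * v powr (p - 1) \<le> a powr p / p + (1 - 1 / p) * v powr p"
proof (cases "a = 0")
  case True
  then show ?thesis using assms by (auto simp: field_simps)
next
  case False
  have "(a powr p) powr (1/p) * (v powr p) powr (1 - 1/p) \<le> 1/p * a powr p + (1 - 1/p) * v powr p"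
    using assms False by (intro Youngs_inequality_0) auto
  moreover have "p * (1 - 1/p) = p - 1"
    using assms by (simp add: field_simps)
  ultimately show ?thesis
    using assms by (simp add: powr_powr)
qed

text \<open>Duality: pair \<open>z \<mapsto> g (z cis \<theta>)\<close> with the extremal functional for \<open>g (r cis \<theta>)\<close> and apply the maximum
  principle in \<open>z\<close>. The shift by \<open>\<delta>\<close> keeps that functional continuous at the zeros of \<open>g\<close>.\<close>
lemma circle_mean_mono_aux:
  assumes hol: "g holomorphic_on ball 0 1" and p: "1 \<le> p" and r: "0 \<le> r" "r \<le> s" "s < 1"
    and \<delta>: "0 < \<delta>"
  defines "v \<equiv> \<lambda>\<theta>. norm (g (of_real r * cis \<theta>)) + \<delta>"
  shows "integral {0..2*pi} (\<lambda>\<theta>. v \<theta> powr p)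
       \<le> integral {0..2*pi} (\<lambda>\<theta>. norm (g (of_real s * cis \<theta>)) powr p)
         + 2 * p * \<delta> * integral {0..2*pi} (\<lambda>\<theta>. v \<theta> powr (p - 1))"
proof -
  define u where "u \<theta> = g (of_real r * cis \<theta>)" for \<theta>
  \<comment> \<open>For \<open>\<delta> = 0\<close> the product of \<open>h\<close> with
    \<open>u\<close> would be exactly \<open>norm u powr p\<close>, while \<open>norm h\<close>
    would be \<open>norm u powr (p - 1)\<close>: equality in Young's inequality.\<close>
  define h where "h \<theta> = cnj (u \<theta>) * of_real (v \<theta> powr (p - 2))" for \<theta>
  define \<Phi> where "\<Phi> z = integral {0..2*pi} (\<lambda>\<theta>. g (z * cis \<theta>) * h \<theta>)" for z
  define I where "I = integral {0..2*pi} (\<lambda>\<theta>. norm (g (of_real s * cis \<theta>)) powr p)"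
  define V where "V = integral {0..2*pi} (\<lambda>\<theta>. v \<theta> powr p)"
  define V1 where "V1 = integral {0..2*pi} (\<lambda>\<theta>. v \<theta> powr (p - 1))"
  have contg: "continuous_on (ball 0 1) g"
    using hol by (rule holomorphic_on_imp_continuous_on)
  have vpos: "v \<theta> > 0" for \<theta>
    using \<delta> by (simp add: v_def add_nonneg_pos)
  have contu: "continuous_on A u" for A
    unfolding u_def using r by (intro continuous_on_circle[OF contg]) auto
  have contv: "continuous_on A v" for A
    unfolding v_def using contu[of A] by (intro continuous_intros) (auto simp: u_def)
  have contvp: "continuous_on A (\<lambda>\<theta>. v \<theta> powr q)" for A q
    by (intro continuous_on_powr contv continuous_on_const) (metis vpos less_irrefl)
  have conth: "continuous_on A h" for A
    unfolding h_def by (intro continuous_intros contu contvp)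
  have uv: "norm (u \<theta>) = v \<theta> - \<delta>" for \<theta>
    by (simp add: u_def v_def)
  have hnorm: "norm (h \<theta>) \<le> v \<theta> powr (p - 1)" for \<theta>
  proof -
    have "norm (h \<theta>) = norm (u \<theta>) * v \<theta> powr (p - 2)"
      by (simp add: h_def norm_mult)
    also have "\<dots> \<le> v \<theta> * v \<theta> powr (p - 2)"
      using \<delta> by (intro mult_right_mono) (auto simp: uv)
    also have "\<dots> = v \<theta> powr (p - 1)"
      using vpos[of \<theta>] by (simp add: powr_mult_base)
    finally show ?thesis .
  qed
  have hol\<Phi>: "\<Phi> holomorphic_on ball 0 1"
  proof -
    have "(\<lambda>z. integral (cbox 0 (2*pi)) (\<lambda>\<theta>. g (z * cis \<theta>) * h \<theta>)) holomorphic_on ball 0 1"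
    proof (rule leibniz_rule_holomorphic[where
          fx = "\<lambda>z \<theta>. deriv g (z * cis \<theta>) * cis \<theta> * h \<theta>"])
      fix z :: complex and \<theta> :: real
      assume z: "z \<in> ball 0 1"
      have "(g has_field_derivative deriv g (z * cis \<theta>)) (at (z * cis \<theta>))"
        using hol z by (intro holomorphic_derivI[OF hol]) (auto simp: norm_mult)
      moreover have "((\<lambda>z. z * cis \<theta>) has_field_derivative cis \<theta>) (at z)"
        by (auto intro!: derivative_eq_intros)
      ultimately have "((\<lambda>z. g (z * cis \<theta>)) has_field_derivative deriv g (z * cis \<theta>) * cis \<theta>) (at z)"
        by (rule DERIV_chain2)
      then show "((\<lambda>z. g (z * cis \<theta>) * h \<theta>) has_field_derivative
              deriv g (z * cis \<theta>) * cis \<theta> * h \<theta>) (at z within ball 0 1)"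
        by (rule DERIV_cmult_right[OF has_field_derivative_at_within])
    next
      fix z :: complex
      assume "z \<in> ball 0 1"
      then show "(\<lambda>\<theta>. g (z * cis \<theta>) * h \<theta>) integrable_on cbox 0 (2*pi)"
        by (intro integrable_continuous continuous_intros conth continuous_on_circle[OF contg]) auto
    next
      have "continuous_on (ball 0 1) (deriv g)"
        by (intro holomorphic_on_imp_continuous_on holomorphic_deriv hol) auto
      then have "continuous_on (ball 0 1 \<times> cbox 0 (2*pi)) (\<lambda>x. deriv g (fst x * cis (snd x)))"
        by (rule continuous_on_compose2) (auto intro!: continuous_intros simp: norm_mult)
      moreover have "continuous_on (ball 0 1 \<times> cbox 0 (2*pi)) (\<lambda>x::complex \<times> real. h (snd x))"
        by (rule continuous_on_compose2[OF conth[of UNIV]]) (auto intro!: continuous_intros)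
      ultimately show "continuous_on (ball 0 1 \<times> cbox 0 (2*pi))
           (\<lambda>(z, \<theta>). deriv g (z * cis \<theta>) * cis \<theta> * h \<theta>)"
        unfolding case_prod_unfold by (intro continuous_intros)
    qed auto
    then show ?thesis by (simp add: \<Phi>_def[abs_def])
  qed
  have bound: "norm (\<Phi> z) \<le> I / p + (1 - 1 / p) * V" if z: "norm z = s" for z
  proof -
    have zlt: "norm z < 1" using z r by simp
    have "norm (\<Phi> z) \<le> integral {0..2*pi} (\<lambda>\<theta>. norm (g (z * cis \<theta>)) powr p / p + (1 - 1/p) * v \<theta> powr p)"
      unfolding \<Phi>_def
    proof (rule integral_norm_bound_integral)
      show "(\<lambda>\<theta>. g (z * cis \<theta>) * h \<theta>) integrable_on {0..2*pi}"
        using zlt by (intro integrable_continuous_real continuous_intros conth continuous_on_circle[OF contg])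
      show "(\<lambda>\<theta>. norm (g (z * cis \<theta>)) powr p / p + (1 - 1/p) * v \<theta> powr p) integrable_on {0..2*pi}"
        using zlt p by (intro integrable_continuous_real continuous_intros contvp
            continuous_on_circle_powr[OF contg]) auto
      fix \<theta>
      have "norm (g (z * cis \<theta>) * h \<theta>) \<le> norm (g (z * cis \<theta>)) * v \<theta> powr (p - 1)"
        by (simp add: norm_mult mult_left_mono hnorm)
      also have "\<dots> \<le> norm (g (z * cis \<theta>)) powr p / p + (1 - 1/p) * v \<theta> powr p"
        using p vpos by (intro mult_powr_le) auto
      finally show "norm (g (z * cis \<theta>) * h \<theta>) \<le> norm (g (z * cis \<theta>)) powr p / p + (1 - 1/p) * v \<theta> powr p" .
    qed
    also have "\<dots> = integral {0..2*pi} (\<lambda>\<theta>. norm (g (z * cis \<theta>)) powr p / p)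
        + integral {0..2*pi} (\<lambda>\<theta>. (1 - 1/p) * v \<theta> powr p)"
      using zlt p by (intro integral_add integrable_continuous_real continuous_intros contvp
            continuous_on_circle_powr[OF contg]) auto
    also have "\<dots> = I / p + (1 - 1 / p) * V"
      using circle_integral_rotate[OF contg zlt, of p] p z by (simp add: I_def V_def)
    finally show ?thesis .
  qed
  have "norm (\<Phi> (of_real r)) \<le> I / p + (1 - 1 / p) * V"
  proof (rule maximum_modulus_frontier[of \<Phi> "cball 0 s"])
    show "\<Phi> holomorphic_on interior (cball 0 s)"
      using r by (intro holomorphic_on_subset[OF hol\<Phi>]) auto
    show "continuous_on (closure (cball 0 s)) \<Phi>"
      using r by (intro continuous_on_subset[OF holomorphic_on_imp_continuous_on[OF hol\<Phi>]]) auto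
  qed (use r bound in auto)
  \<comment> \<open>At \<open>z = r\<close> the integrand is real and nonnegative, and
    \<open>(v - \<delta>)\<^sup>2 \<ge> v\<^sup>2 - 2 * \<delta> * v\<close> shows that the shift
    costs only a term of order \<open>\<delta>\<close>.\<close>
  moreover have "V - 2 * \<delta> * V1 \<le> norm (\<Phi> (of_real r))"
  proof -
    have *: "g (of_real r * cis \<theta>) * h \<theta> = of_real ((norm (u \<theta>))\<^sup>2 * v \<theta> powr (p - 2))" for \<theta>
      by (simp add: h_def complex_norm_square flip: u_def of_real_power)
    have "\<Phi> (of_real r) = integral {0..2*pi} (\<lambda>\<theta>. of_real ((norm (u \<theta>))\<^sup>2 * v \<theta> powr (p - 2)))"
      unfolding \<Phi>_def * ..
    also have "\<dots> = of_real (integral {0..2*pi} (\<lambda>\<theta>. (norm (u \<theta>))\<^sup>2 * v \<theta> powr (p - 2)))"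
      by (intro integral_unique has_integral_of_real integrable_integral integrable_continuous_real
           continuous_intros contu contvp)
    finally have "norm (\<Phi> (of_real r)) \<ge> integral {0..2*pi} (\<lambda>\<theta>. (norm (u \<theta>))\<^sup>2 * v \<theta> powr (p - 2))"
      by simp
    moreover have "integral {0..2*pi} (\<lambda>\<theta>. v \<theta> powr p - 2 * \<delta> * v \<theta> powr (p - 1))
        \<le> integral {0..2*pi} (\<lambda>\<theta>. (norm (u \<theta>))\<^sup>2 * v \<theta> powr (p - 2))"
    proof (rule integral_le)
      fix \<theta>
      have e: "v \<theta> powr p = (v \<theta>)\<^sup>2 * v \<theta> powr (p - 2)" "v \<theta> powr (p - 1) = v \<theta> * v \<theta> powr (p - 2)"
        using vpos[of \<theta>] by (simp_all add: powr_diff power2_eq_square)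
      have "((v \<theta>)\<^sup>2 - 2 * \<delta> * v \<theta>) * v \<theta> powr (p - 2) \<le> (v \<theta> - \<delta>)\<^sup>2 * v \<theta> powr (p - 2)"
        by (intro mult_right_mono) (auto simp: power2_eq_square algebra_simps)
      then show "v \<theta> powr p - 2 * \<delta> * v \<theta> powr (p - 1) \<le> (norm (u \<theta>))\<^sup>2 * v \<theta> powr (p - 2)"
        by (simp add: e uv algebra_simps)
    qed (intro integrable_continuous_real continuous_intros contu contvp)+
    moreover have "integral {0..2*pi} (\<lambda>\<theta>. v \<theta> powr p - 2 * \<delta> * v \<theta> powr (p - 1)) = V - 2 * \<delta> * V1"
      unfolding V_def V1_def
      by (subst integral_diff) (auto intro!: integrable_continuous_real continuous_intros contvp)
    ultimately show ?thesis by simp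
  qed
  ultimately have "V - 2 * \<delta> * V1 \<le> I / p + (1 - 1 / p) * V" by simp
  \<comment> \<open>Absorbing \<open>(1 - 1 / p) * V\<close> leaves \<open>V / p\<close> on the
    left; clearing the denominator puts the factor \<open>p\<close> into the error term.\<close>
  then have "V \<le> I + 2 * p * \<delta> * V1"
    using p by (simp add: field_simps)
  then show ?thesis
    by (simp add: V_def I_def V1_def)
qed

text \<open>Let \<open>\<delta>\<close> tend to 0 in the preceding estimate. For
  \<open>\<delta> < 1\<close> the integral in the error term is bounded uniformly, since
  \<open>u\<close> is bounded on the circle, so the error is at most
  \<open>D * \<delta>\<close>.\<close>

lemma circle_mean_mono:
  assumes hol: "g holomorphic_on ball 0 1" and p: "1 \<le> p" and r: "0 \<le> r" "r \<le> s" "s < 1"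
  shows "integral {0..2*pi} (\<lambda>\<theta>. norm (g (of_real r * cis \<theta>)) powr p)
       \<le> integral {0..2*pi} (\<lambda>\<theta>. norm (g (of_real s * cis \<theta>)) powr p)" (is "?I \<le> ?J")
proof -
  have contg: "continuous_on (ball 0 1) g"
    using hol by (rule holomorphic_on_imp_continuous_on)
  define u where "u \<theta> = norm (g (of_real r * cis \<theta>))" for \<theta>
  have contu: "continuous_on A u" for A
    unfolding u_def using r continuous_on_circle[OF contg, of "of_real r" A]
    by (intro continuous_intros) auto
  have "bounded (u ` {0..2*pi})"
    by (intro compact_imp_bounded compact_continuous_image contu) auto
  then obtain K where K: "\<And>\<theta>. \<theta> \<in> {0..2*pi} \<Longrightarrow> u \<theta> \<le> K"
    unfolding bounded_iff by (metis imageI norm_ge_zero abs_le_D1 real_norm_def)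
  have u0: "u \<theta> \<ge> 0" for \<theta> by (simp add: u_def)
  have K0: "K \<ge> 0" using K[of 0] u0[of 0] by auto
  define D where "D = 2 * p * (2 * pi * (K + 1) powr (p - 1))"
  have est: "?I \<le> ?J + D * \<delta>" if \<delta>: "0 < \<delta>" "\<delta> < 1" for \<delta>
  proof -
    have cv: "continuous_on A (\<lambda>\<theta>. (u \<theta> + \<delta>) powr q)" for A q
      using \<delta> u0 by (intro continuous_intros contu) (smt (verit))+
    have "?I \<le> integral {0..2*pi} (\<lambda>\<theta>. (u \<theta> + \<delta>) powr p)"
    proof (rule integral_le)
      show "(\<lambda>\<theta>. norm (g (of_real r * cis \<theta>)) powr p) integrable_on {0..2*pi}"
        using r p by (intro integrable_continuous_real continuous_on_circle_powr[OF contg]) auto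
      show "norm (g (of_real r * cis \<theta>)) powr p \<le> (u \<theta> + \<delta>) powr p" for \<theta>
        using p \<delta> by (intro powr_mono2) (auto simp: u_def)
    qed (intro integrable_continuous_real cv)
    also have "\<dots> \<le> ?J + 2 * p * \<delta> * integral {0..2*pi} (\<lambda>\<theta>. (u \<theta> + \<delta>) powr (p - 1))"
      using circle_mean_mono_aux[OF hol p r \<delta>(1)] by (simp add: u_def)
    also have "integral {0..2*pi} (\<lambda>\<theta>. (u \<theta> + \<delta>) powr (p - 1)) \<le> integral {0..2*pi} (\<lambda>\<theta>. (K + 1) powr (p - 1))"
    proof (rule integral_le)
      show "(u \<theta> + \<delta>) powr (p - 1) \<le> (K + 1) powr (p - 1)" if "\<theta> \<in> {0..2*pi}" for \<theta>
        using \<delta> p K[OF that] u0[of \<theta>] by (intro powr_mono2) auto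
    qed (intro integrable_continuous_real cv continuous_intros)+
    also have "integral {0..2*pi} (\<lambda>\<theta>. (K + 1) powr (p - 1)) = 2 * pi * (K + 1) powr (p - 1)"
      by simp
    finally show ?thesis
      using p \<delta> by (simp add: D_def mult_left_mono algebra_simps)
  qed
  have "((\<lambda>\<delta>. ?J + D * \<delta>) \<longlongrightarrow> ?J + D * 0) (at_right 0)"
    by (intro tendsto_intros)
  moreover have "\<forall>\<^sub>F \<delta> in at_right (0::real). ?I \<le> ?J + D * \<delta>"
    using eventually_at_right_real[OF zero_less_one] by eventually_elim (use est in auto)
  ultimately have "?I \<le> ?J + D * 0"
    by (intro tendsto_lowerbound) auto
  then show ?thesis by simp
qed

text \<open>\<^const>\<open>Lim\<close> is a definite description, so the Hardy norm carries information only once the limit is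
  known to exist.\<close>
lemma Lim_at_left_mono:
  fixes f :: "real \<Rightarrow> ereal"
  assumes "a < b" and mono: "\<And>r s. a < r \<Longrightarrow> r \<le> s \<Longrightarrow> s < b \<Longrightarrow> f r \<le> f s"
  shows "Lim (at_left b) f = (SUP r\<in>{a<..<b}. f r)"
proof (rule tendsto_Lim)
  show "(f \<longlongrightarrow> (SUP r\<in>{a<..<b}. f r)) (at_left b)"
  proof (rule order_tendstoI)
    fix l assume "l < (SUP r\<in>{a<..<b}. f r)"
    then obtain r where r: "a < r" "r < b" "l < f r"
      by (auto simp: less_SUP_iff)
    show "\<forall>\<^sub>F x in at_left b. l < f x"
      using eventually_at_left_real[OF r(2)]
      by eventually_elim (use r mono in \<open>force intro: less_le_trans\<close>)
  next
    fix u assume u: "(SUP r\<in>{a<..<b}. f r) < u"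
    show "\<forall>\<^sub>F x in at_left b. f x < u"
      using eventually_at_left_real[OF assms(1)]
      by eventually_elim (use u in \<open>meson SUP_upper le_less_trans\<close>)
  qed
qed auto

text \<open>A real \<open>SUP\<close> dominates its members only when the set is bounded above;
  compactness of the circle provides this.\<close>

lemma circle_bdd_above:
  fixes g :: "complex \<Rightarrow> complex"
  assumes "continuous_on (ball 0 1) g" and "0 \<le> r" "r < 1"
  shows "bdd_above (range (\<lambda>\<theta>. norm (g (of_real r * cis \<theta>))))"
proof -
  have "bounded (g ` sphere 0 r)"
    using assms by (intro compact_imp_bounded compact_continuous_image
        continuous_on_subset[OF assms(1)]) auto
  then obtain K where "\<And>z. norm z = r \<Longrightarrow> norm (g z) \<le> K"
    unfolding bounded_iff by force
  then show ?thesis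
    using assms by (intro bdd_aboveI[of _ K]) (auto simp: norm_mult)
qed

lemma circle_SUP_mono:
  assumes hol: "g holomorphic_on ball 0 1" and r: "0 \<le> r" "r \<le> s" "s < 1"
  shows "(SUP \<theta>. norm (g (of_real r * cis \<theta>))) \<le> (SUP \<theta>. norm (g (of_real s * cis \<theta>)))" (is "_ \<le> ?S")
proof (rule cSUP_least)
  have cont: "continuous_on (ball 0 1) g"
    using hol by (rule holomorphic_on_imp_continuous_on)
  have *: "norm (g z) \<le> ?S" if "norm z = s" for z
  proof -
    have "z = of_real s * cis (Arg2pi z)"
      using Arg2pi[of z] that by (simp add: cis_conv_exp is_Arg_def)
    then show ?thesis
      using r by (metis (no_types, lifting) UNIV_I cSUP_upper circle_bdd_above[OF cont] order_trans)
  qed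
  fix \<theta> :: real
  show "norm (g (of_real r * cis \<theta>)) \<le> ?S"
  proof (rule maximum_modulus_frontier[of g "cball 0 s"])
    show "g holomorphic_on interior (cball 0 s)"
      using r by (intro holomorphic_on_subset[OF hol]) auto
    show "continuous_on (closure (cball 0 s)) g"
      using r by (intro continuous_on_subset[OF cont]) auto
  qed (use r * in \<open>auto simp: norm_mult\<close>)
qed auto

section \<open>Consequences of norm bounds in Hardy spaces\<close>

lemma hardy_norm_infinity:
  assumes "g holomorphic_on ball 0 1"
  shows "hardy_norm \<infinity> g = (SUP r\<in>{0<..<1}. ereal (SUP \<theta>. norm (g (of_real r * cis \<theta>))))"
  unfolding hardy_norm_def using circle_SUP_mono[OF assms] by (simp add: Lim_at_left_mono)

lemma hardy_norm_ereal:
  assumes "g holomorphic_on ball 0 1" and "1 \<le> p"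
  shows "hardy_norm (ereal p) g = (SUP r\<in>{0<..<1}. ereal (integral_mean p g r))"
proof -
  have "integral_mean p g r \<le> integral_mean p g s" if "0 < r" "r \<le> s" "s < 1" for r s
    unfolding integral_mean_def
    using assms that circle_mean_mono[OF assms, of r s]
    by (intro powr_mono2 mult_left_mono mult_nonneg_nonneg integral_nonneg integrable_continuous_real
        continuous_on_circle_powr holomorphic_on_imp_continuous_on) auto
  then show ?thesis
    unfolding hardy_norm_def by (simp add: Lim_at_left_mono)
qed

text \<open>Reduces all exponents to the mean of the first power, by Young's inequality against the
  constant 1 for finite \<open>p\<close> and pointwise for \<open>p = \<infinity>\<close>. This is
  all that is later used of a competitor's norm, so the final constant can be chosen independently
  of \<open>p\<close>.\<close>

lemma circle_mean_le:
  assumes hol: "g holomorphic_on ball 0 1" and p: "1 \<le> p" and norm: "hardy_norm p g \<le> 1"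
    and r: "0 < r" "r < 1"
  shows "integral {0..2*pi} (\<lambda>\<theta>. norm (g (of_real r * cis \<theta>))) \<le> 2 * pi"
proof -
  have cont: "continuous_on (ball 0 1) g"
    using hol by (rule holomorphic_on_imp_continuous_on)
  have int: "(\<lambda>\<theta>. norm (g (of_real r * cis \<theta>))) integrable_on {0..2*pi}"
    using r by (intro integrable_continuous_real continuous_intros continuous_on_circle[OF cont]) auto
  show ?thesis
  proof (cases p)
    case (real q)
    then have q: "1 \<le> q" using p by simp
    have int': "(\<lambda>\<theta>. norm (g (of_real r * cis \<theta>)) powr q) integrable_on {0..2*pi}"
      using r q by (intro integrable_continuous_real continuous_on_circle_powr[OF cont]) auto
    have int2: "(\<lambda>\<theta>. norm (g (of_real r * cis \<theta>)) powr q / q) integrable_on {0..2*pi}"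
      using integrable_on_mult_right[OF int', of "1/q"] by (simp add: mult.commute)
    define J where "J = integral {0..2*pi} (\<lambda>\<theta>. norm (g (of_real r * cis \<theta>)) powr q)"
    have "ereal (integral_mean q g r) \<le> hardy_norm p g"
      unfolding real hardy_norm_ereal[OF hol q] using r by (intro SUP_upper) auto
    also have "\<dots> \<le> ereal 1" using norm by (simp add: one_ereal_def)
    finally have "(1 / (2*pi) * J) powr (1 / q) \<le> 1"
      by (simp add: integral_mean_def J_def)
    moreover have "1 / (2*pi) * J \<ge> 0"
      unfolding J_def by (intro mult_nonneg_nonneg integral_nonneg int') auto
    ultimately have "1 / (2*pi) * J \<le> 1"
      using q gr_one_powr[of "1 / (2*pi) * J" "1/q"] by fastforce
    then have J: "J \<le> 2 * pi" by (simp add: field_simps)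
    have "integral {0..2*pi} (\<lambda>\<theta>. norm (g (of_real r * cis \<theta>)))
        \<le> integral {0..2*pi} (\<lambda>\<theta>. norm (g (of_real r * cis \<theta>)) powr q / q + (1 - 1/q))"
      using mult_powr_le[OF q _ zero_less_one]
      by (intro integral_le int integrable_add int2) auto
    also have "\<dots> = J / q + (1 - 1/q) * (2 * pi)"
      unfolding J_def by (subst integral_add) (auto intro!: int2)
    also have "\<dots> \<le> 2 * pi / q + (1 - 1/q) * (2*pi)"
      using J q by (intro add_mono divide_right_mono) auto
    finally show ?thesis using q by (simp add: field_simps)
  next
    case PInf
    have "norm (g (of_real r * cis \<theta>)) \<le> 1" for \<theta>
    proof -
      have "norm (g (of_real r * cis \<theta>)) \<le> (SUP \<theta>. norm (g (of_real r * cis \<theta>)))"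
        using r by (intro cSUP_upper circle_bdd_above[OF cont]) auto
      also have "ereal \<dots> \<le> hardy_norm p g"
        unfolding PInf hardy_norm_infinity[OF hol] using r by (intro SUP_upper) auto
      also have "\<dots> \<le> ereal 1" using norm by (simp add: one_ereal_def)
      finally show ?thesis by simp
    qed
    then have "integral {0..2*pi} (\<lambda>\<theta>. norm (g (of_real r * cis \<theta>))) \<le> integral {0..2*pi} (\<lambda>\<theta>. 1)"
      by (intro integral_le int) auto
    then show ?thesis by simp
  qed (use p in auto)
qed

text \<open>Admits the square of a Blaschke product as a competitor for every exponent.\<close>

lemma hardy_norm_le_one:
  assumes hol: "g holomorphic_on ball 0 1" and p: "1 \<le> p" and le: "\<And>z. norm z < 1 \<Longrightarrow> norm (g z) \<le> 1"
  shows "hardy_norm p g \<le> 1"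
proof (cases p)
  case (real q)
  then have q: "1 \<le> q" using p by simp
  have "integral_mean q g r \<le> 1" if r: "0 < r" "r < 1" for r
  proof -
    have cont: "continuous_on (ball 0 1) g"
      using hol by (rule holomorphic_on_imp_continuous_on)
    have int: "(\<lambda>\<theta>. norm (g (of_real r * cis \<theta>)) powr q) integrable_on {0..2*pi}"
      using r q by (intro integrable_continuous_real continuous_on_circle_powr[OF cont]) auto
    have "integral {0..2*pi} (\<lambda>\<theta>. norm (g (of_real r * cis \<theta>)) powr q) \<le> integral {0..2*pi} (\<lambda>\<theta>. 1)"
      using r q le by (intro integral_le int) (auto simp: norm_mult intro!: powr_le1)
    moreover have "0 \<le> integral {0..2*pi} (\<lambda>\<theta>. norm (g (of_real r * cis \<theta>)) powr q)"
      by (intro integral_nonneg int) auto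
    ultimately show ?thesis
      unfolding integral_mean_def using q by (intro powr_le1 mult_nonneg_nonneg) auto
  qed
  then show ?thesis
    unfolding real hardy_norm_ereal[OF hol q] by (intro SUP_least) (auto simp: one_ereal_def)
next
  case PInf
  have "(SUP \<theta>. norm (g (of_real r * cis \<theta>))) \<le> 1" if "0 < r" "r < 1" for r
    using that le by (intro cSUP_least) (auto simp: norm_mult)
  then show ?thesis
    unfolding PInf hardy_norm_infinity[OF hol] by (intro SUP_least) (auto simp: one_ereal_def)
qed (use p in auto)

text \<open>Cauchy's formula on the circle of radius \<open>r\<close>: the kernel has modulus at
  most \<open>r / (r - norm z)\<close>, and \<open>r < 1\<close>.\<close>

lemma norm_le_circle_mean:
  assumes hol: "f holomorphic_on ball 0 1" and r: "norm z < r" "r < 1"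
    and le: "integral {0..2*pi} (\<lambda>\<theta>. norm (f (of_real r * cis \<theta>))) \<le> 2 * pi * K"
  shows "norm (f z) \<le> K / (r - norm z)"
proof -
  have r0: "r > 0" using r norm_ge_zero[of z] by linarith
  have cont: "continuous_on (ball 0 1) f"
    using hol by (rule holomorphic_on_imp_continuous_on)
  have "((\<lambda>u. f u / (u - z)) has_contour_integral (2 * of_real pi * \<i> * f z)) (circlepath 0 r)"
    using r by (intro Cauchy_integral_circlepath continuous_on_subset[OF cont]
        holomorphic_on_subset[OF hol]) auto
  then have I: "((\<lambda>t. f (of_real r * cis t) / (of_real r * cis t - z) * of_real r * \<i> * cis t)
      has_integral 2 * of_real pi * \<i> * f z) {0..2*pi}"
    unfolding circlepath_def by (subst (asm) has_contour_integral_part_circlepath_iff) auto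
  have int: "(\<lambda>\<theta>. norm (f (of_real r * cis \<theta>))) integrable_on {0..2*pi}"
    using r r0 by (intro integrable_continuous_real continuous_intros continuous_on_circle[OF cont]) auto
  have "norm (2 * of_real pi * \<i> * f z) \<le> integral {0..2*pi} (\<lambda>\<theta>. norm (f (of_real r * cis \<theta>)) * (1 / (r - norm z)))"
    unfolding integral_unique[OF I, symmetric]
  proof (rule integral_norm_bound_integral)
    show "(\<lambda>\<theta>. norm (f (of_real r * cis \<theta>)) * (1 / (r - norm z))) integrable_on {0..2*pi}"
      by (rule integrable_on_mult_left[OF int])
    fix \<theta> :: real
    have "r - norm z \<le> norm (of_real r * cis \<theta> - z)"
      using norm_triangle_ineq2[of "of_real r * cis \<theta>" z] r0 by (simp add: norm_mult)
    then have "norm (f (of_real r * cis \<theta>)) * r / norm (of_real r * cis \<theta> - z) \<le> norm (f (of_real r * cis \<theta>)) * 1 / (r - norm z)"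
      using r r0 by (intro frac_le mult_left_mono) auto
    then show "norm (f (of_real r * cis \<theta>) / (of_real r * cis \<theta> - z) * of_real r * \<i> * cis \<theta>)
        \<le> norm (f (of_real r * cis \<theta>)) * (1 / (r - norm z))"
      using r0 by (simp add: norm_mult norm_divide)
  qed (use I in blast)
  also have "\<dots> = integral {0..2*pi} (\<lambda>\<theta>. norm (f (of_real r * cis \<theta>))) / (r - norm z)"
    by simp
  also have "\<dots> \<le> 2 * pi * K / (r - norm z)"
    using le r by (intro divide_right_mono) auto
  finally have "2 * pi * norm (f z) \<le> 2 * pi * (K / (r - norm z))"
    by (simp add: norm_mult)
  then show ?thesis by (simp del: times_divide_eq_right)
qed

section \<open>Finite Blaschke products\<close>

text \<open>For two points of the disc the modulus is their pseudohyperbolic distance.\<close>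

definition blaschke_factor :: "complex \<Rightarrow> complex \<Rightarrow> complex" where
  "blaschke_factor w z = (z - w) / (1 - cnj w * z)"

text \<open>Indexing by a set keeps all zeros simple; multiplicity two arises only when the list is
  doubled at the end. For infinite \<open>F\<close> the product takes the default value 1.\<close>

definition blaschke_prod :: "complex set \<Rightarrow> complex \<Rightarrow> complex" where
  "blaschke_prod F z = (\<Prod>w\<in>F. blaschke_factor w z)"

lemma blaschke_conv_prod:
  "distinct ws \<Longrightarrow> blaschke ws z = blaschke_prod (set ws) z"
  by (simp add: blaschke_def blaschke_prod_def blaschke_factor_def prod.distinct_set_conv_list)

lemma blaschke_append: "blaschke (us @ ws) z = blaschke us z * blaschke ws z"
  by (simp add: blaschke_def)

lemma blaschke_denom_nonzero:
  assumes "norm w < 1" "norm z \<le> 1"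
  shows "1 - cnj w * z \<noteq> 0"
proof
  assume "1 - cnj w * z = 0"
  then have "norm (cnj w * z) = 1" by (metis eq_iff_diff_eq_0 norm_one)
  moreover have "norm (cnj w * z) \<le> norm w * 1"
    unfolding norm_mult complex_mod_cnj using assms by (intro mult_left_mono) auto
  ultimately show False using assms by simp
qed

text \<open>Common source of the modulus estimates for one factor: at most 1 on the closed disc,
  equal to 1 on its boundary, and uniformly below 1 on smaller discs.\<close>

lemma blaschke_factor_identity:
  "(norm (1 - cnj w * z))\<^sup>2 - (norm (z - w))\<^sup>2 = (1 - (norm z)\<^sup>2) * (1 - (norm w)\<^sup>2)"
  unfolding cmod_power2 by (simp add: power2_eq_square algebra_simps)

lemma norm_blaschke_factor_power2:
  assumes "norm w < 1" "norm z \<le> 1"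
  shows "(norm (blaschke_factor w z))\<^sup>2
       = 1 - (1 - (norm z)\<^sup>2) * (1 - (norm w)\<^sup>2) / (norm (1 - cnj w * z))\<^sup>2"
  using blaschke_denom_nonzero[OF assms]
  unfolding blaschke_factor_identity[symmetric]
  by (simp add: blaschke_factor_def norm_divide power_divide diff_divide_distrib[of "_ ^ 2"])

lemma norm_blaschke_factor_le_1:
  assumes "norm w < 1" "norm z \<le> 1"
  shows "norm (blaschke_factor w z) \<le> 1"
proof -
  have "(norm (blaschke_factor w z))\<^sup>2 \<le> 1\<^sup>2"
    unfolding norm_blaschke_factor_power2[OF assms] using assms
    by (auto intro!: divide_nonneg_nonneg mult_nonneg_nonneg simp: power_le_one)
  then show ?thesis by (rule power2_le_imp_le) auto
qed

lemma norm_blaschke_factor_eq_1: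
  assumes "norm w < 1" "norm z = 1"
  shows "norm (blaschke_factor w z) = 1"
proof -
  have "(norm (blaschke_factor w z))\<^sup>2 = 1"
    using norm_blaschke_factor_power2[of w z] assms by simp
  then show ?thesis by (simp add: power2_eq_1_iff) (use norm_ge_zero[of "blaschke_factor w z"] in linarith)
qed

lemma norm_blaschke_factor_commute: "norm (blaschke_factor w z) = norm (blaschke_factor z w)"
proof -
  have "norm (1 - cnj w * z) = norm (cnj (1 - cnj w * z))" by (rule complex_mod_cnj[symmetric])
  also have "\<dots> = norm (1 - cnj z * w)" by (simp add: mult.commute)
  finally show ?thesis
    by (simp add: blaschke_factor_def norm_divide norm_minus_commute)
qed

text \<open>Inside a compact subdisc pseudohyperbolic distances stay away from 1, so products decay
  geometrically in the number of zeros. The 4 is the square of the bound 2 for the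
  denominator.\<close>

lemma norm_blaschke_factor_le:
  assumes "norm w \<le> S" "norm z \<le> S" "0 \<le> S" "S < 1"
  shows "(norm (blaschke_factor w z))\<^sup>2 \<le> 1 - (1 - S\<^sup>2)\<^sup>2 / 4"
proof -
  have sq: "(norm w)\<^sup>2 \<le> S\<^sup>2" "(norm z)\<^sup>2 \<le> S\<^sup>2" "S\<^sup>2 \<le> 1"
    using assms by (auto intro: power_mono simp: power_le_one)
  have n: "norm (1 - cnj w * z) \<le> 2"
  proof -
    have "norm (1 - cnj w * z) \<le> norm (1::complex) + norm (cnj w * z)" by (rule norm_triangle_ineq4)
    also have "norm (cnj w * z) \<le> 1 * 1"
      unfolding norm_mult using assms by (intro mult_mono) auto
    finally show ?thesis by simp
  qed
  have pos: "norm (1 - cnj w * z) > 0"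
    using blaschke_denom_nonzero[of w z] assms by simp
  have "(1 - S\<^sup>2)\<^sup>2 / 4 \<le> (1 - (norm z)\<^sup>2) * (1 - (norm w)\<^sup>2) / (norm (1 - cnj w * z))\<^sup>2"
  proof (rule frac_le)
    show "(1 - S\<^sup>2)\<^sup>2 \<le> (1 - (norm z)\<^sup>2) * (1 - (norm w)\<^sup>2)"
      unfolding power2_eq_square[of "1 - S\<^sup>2"] using sq by (intro mult_mono) auto
    show "(norm (1 - cnj w * z))\<^sup>2 \<le> 4"
      using power_mono[OF n, of 2] by simp
  qed (use pos assms in \<open>auto intro!: mult_nonneg_nonneg simp: power_le_one\<close>)
  then show ?thesis
    using norm_blaschke_factor_power2[of w z] assms by simp
qed

lemma blaschke_factor_eq_0_iff:
  assumes "norm w < 1" "norm z \<le> 1"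
  shows "blaschke_factor w z = 0 \<longleftrightarrow> z = w"
  using blaschke_denom_nonzero[OF assms] by (simp add: blaschke_factor_def)

section \<open>Zeros, modulus and regularity of finite products\<close>

lemma blaschke_prod_insert:
  "finite F \<Longrightarrow> w \<notin> F \<Longrightarrow> blaschke_prod (insert w F) z = blaschke_factor w z * blaschke_prod F z"
  by (simp add: blaschke_prod_def)

lemma blaschke_prod_remove:
  "finite F \<Longrightarrow> w \<in> F \<Longrightarrow> blaschke_prod F z = blaschke_factor w z * blaschke_prod (F - {w}) z"
  by (simp add: blaschke_prod_def prod.remove)

lemma blaschke_prod_eq_0:
  "finite F \<Longrightarrow> z \<in> F \<Longrightarrow> blaschke_prod F z = 0"
  by (auto simp: blaschke_prod_def blaschke_factor_def)

lemma blaschke_prod_nonzero: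
  assumes "F \<subseteq> ball 0 1" "norm z \<le> 1" "z \<notin> F"
  shows "blaschke_prod F z \<noteq> 0"
proof (cases "finite F")
  case True
  then show ?thesis
    using assms blaschke_factor_eq_0_iff by (fastforce simp: blaschke_prod_def)
qed (simp add: blaschke_prod_def)

lemma norm_blaschke_prod_le_1:
  assumes "F \<subseteq> ball 0 1" "norm z \<le> 1"
  shows "norm (blaschke_prod F z) \<le> 1"
  unfolding blaschke_prod_def prod_norm[symmetric]
  using assms by (intro prod_le_1) (auto intro!: norm_blaschke_factor_le_1)

lemma norm_blaschke_prod_eq_1:
  assumes "F \<subseteq> ball 0 1" "norm z = 1"
  shows "norm (blaschke_prod F z) = 1"
  unfolding blaschke_prod_def prod_norm[symmetric]
  using assms by (intro prod.neutral) (auto intro!: norm_blaschke_factor_eq_1)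

lemma holomorphic_blaschke_prod:
  assumes "F \<subseteq> ball 0 1"
  shows "blaschke_prod F holomorphic_on ball 0 1"
  unfolding blaschke_prod_def[abs_def] blaschke_factor_def
  using assms blaschke_denom_nonzero by (intro holomorphic_intros) fastforce

lemma continuous_on_blaschke_prod:
  assumes "F \<subseteq> ball 0 1"
  shows "continuous_on (cball 0 1) (blaschke_prod F)"
  unfolding blaschke_prod_def[abs_def] blaschke_factor_def
  using assms blaschke_denom_nonzero by (intro continuous_intros) fastforce

text \<open>Uniform continuity compares \<open>z\<close> with its radial projection, where the
  modulus is 1. It permits division by the product on a circle inside the disc, where competitors
  are defined.\<close>

lemma blaschke_prod_near_boundary:
  assumes "F \<subseteq> ball 0 1" and "c < 1"
  obtains r where "0 < r" "r < 1" "\<And>z. r \<le> norm z \<Longrightarrow> norm z \<le> 1 \<Longrightarrow> c < norm (blaschke_prod F z)"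
proof -
  have "uniformly_continuous_on (cball 0 1) (blaschke_prod F)"
    by (intro compact_uniformly_continuous continuous_on_blaschke_prod assms) auto
  then obtain d where d: "d > 0" "\<And>x y. x \<in> cball 0 1 \<Longrightarrow> y \<in> cball 0 1 \<Longrightarrow> dist y x < d \<Longrightarrow>
      dist (blaschke_prod F y) (blaschke_prod F x) < 1 - c"
    unfolding uniformly_continuous_on_def using assms(2) by (metis diff_gt_0_iff_gt)
  \<comment> \<open>The lower bound \<open>1 / 2\<close> keeps \<open>z\<close> away from 0, so that
    the projection \<open>z / norm z\<close> is defined.\<close>
  define r where "r = max (1/2) (1 - d / 2)"
  show ?thesis
  proof (rule that[of r])
    fix z :: complex
    assume z: "r \<le> norm z" "norm z \<le> 1"
    then have z0: "z \<noteq> 0" by (auto simp: r_def)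
    define y where "y = z / of_real (norm z)"
    have y: "norm y = 1" using z0 by (simp add: y_def norm_divide)
    have "z - y = y * (of_real (norm z) - 1)" using z0 by (simp add: y_def field_simps)
    also have "of_real (norm z) - 1 = (of_real (norm z - 1) :: complex)" by simp
    finally have "dist z y = \<bar>norm z - 1\<bar>"
      using y by (simp only: dist_norm norm_mult norm_of_real mult_1)
    also have "\<dots> < d" using z d(1) by (auto simp: r_def)
    finally have "dist (blaschke_prod F z) (blaschke_prod F y) < 1 - c"
      using d(2) y z by simp
    moreover have "norm (blaschke_prod F y) = 1"
      using norm_blaschke_prod_eq_1[OF assms(1) y] .
    ultimately show "c < norm (blaschke_prod F z)"
      using norm_triangle_ineq2[of "blaschke_prod F y" "blaschke_prod F z"]
      by (simp add: dist_norm norm_minus_commute)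
  qed (use d in \<open>auto simp: r_def\<close>)
qed

section \<open>Division by the zeros and interpolation\<close>

text \<open>Split off one zero at a time: the singularity at \<open>w\<close> is removable, and the
  quotient still vanishes at the other zeros because the factor of \<open>w\<close> does
  not.\<close>

lemma blaschke_prod_divides:
  assumes "finite F" "F \<subseteq> ball 0 1" "f holomorphic_on ball 0 1" "\<And>w. w \<in> F \<Longrightarrow> f w = 0"
  shows "\<exists>h. h holomorphic_on ball 0 1 \<and> (\<forall>z\<in>ball 0 1. f z = blaschke_prod F z * h z)"
  using assms
proof (induction F arbitrary: f rule: finite_induct)
  case empty
  then show ?case by (auto simp: blaschke_prod_def)
next
  case (insert w F)
  have w: "norm w < 1" using insert.prems by auto
  \<comment> \<open>As \<open>f w = 0\<close>, this is \<open>f\<close> divided by the factor of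
    \<open>w\<close>, with the removable singularity filled in by the derivative.\<close>
  define k where "k z = (if z = w then deriv f w else (f z - f w) / (z - w)) * (1 - cnj w * z)" for z
  have "k holomorphic_on ball 0 1"
    unfolding k_def[abs_def] by (intro holomorphic_intros pole_lemma_open insert.prems) auto
  moreover have fk: "f z = blaschke_factor w z * k z" if "z \<in> ball 0 1" for z
    using that blaschke_denom_nonzero[OF w, of z] insert.prems(3)[of w]
    by (auto simp: k_def blaschke_factor_def)
  moreover have "k v = 0" if "v \<in> F" for v
    using that insert fk[of v] blaschke_factor_eq_0_iff[OF w, of v]
    by auto
  ultimately obtain h where "h holomorphic_on ball 0 1" "\<forall>z\<in>ball 0 1. k z = blaschke_prod F z * h z"
    using insert.IH[of k] insert.prems by auto
  with fk show ?case
    using insert.hyps by (intro exI[of _ h]) (simp add: blaschke_prod_insert)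
qed

text \<open>The quotient \<open>h\<close> is controlled by its mean on a circle where the product
  exceeds \<open>1 / 2\<close>. The contribution of \<open>L\<close> at \<open>z\<close> is kept as
  a sum, because comparing it with the maximum of the full product needs the size of each reduced
  product at \<open>z\<close>.\<close>

lemma blaschke_interpolation_bound:
  fixes \<epsilon> m R :: real
  assumes F: "finite F" "F \<subseteq> ball 0 1"
    and g: "g holomorphic_on ball 0 1"
    and mean: "\<And>r. 0 < r \<Longrightarrow> r < 1 \<Longrightarrow> integral {0..2*pi} (\<lambda>\<theta>. norm (g (of_real r * cis \<theta>))) \<le> 2 * pi"
    and \<epsilon>: "\<And>w. w \<in> F \<Longrightarrow> norm (g w) \<le> \<epsilon>" "0 \<le> \<epsilon>"
    and m: "0 < m" "\<And>w. w \<in> F \<Longrightarrow> m \<le> norm (blaschke_prod (F - {w}) w)"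
    and z: "norm z \<le> R" "R < 1"
  shows "norm (g z) \<le> norm (blaschke_prod F z) * (4 * (1 + card F * (\<epsilon> / m)) / (1 - R))
           + (\<Sum>w\<in>F. \<epsilon> / m * norm (blaschke_prod (F - {w}) z))"
proof -
  define L where "L z = (\<Sum>w\<in>F. g w / blaschke_prod (F - {w}) w * blaschke_prod (F - {w}) z)" for z
  define K where "K = card F * (\<epsilon> / m)"
  have K0: "K \<ge> 0" using \<epsilon> m by (simp add: K_def)
  have coeff: "norm (g w / blaschke_prod (F - {w}) w) \<le> \<epsilon> / m" if "w \<in> F" for w
    unfolding norm_divide using \<epsilon> m that by (intro frac_le) auto
  have L: "norm (L z) \<le> (\<Sum>w\<in>F. \<epsilon> / m * norm (blaschke_prod (F - {w}) z))" for z
    unfolding L_def by (intro sum_norm_le) (simp only: norm_mult mult_right_mono[OF coeff] norm_ge_zero)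
  have LK: "norm (L z) \<le> K" if "norm z \<le> 1" for z
  proof -
    have "(\<Sum>w\<in>F. \<epsilon> / m * norm (blaschke_prod (F - {w}) z)) \<le> (\<Sum>w\<in>F. \<epsilon> / m * 1)"
      using that F \<epsilon> m by (intro sum_mono mult_left_mono norm_blaschke_prod_le_1) auto
    then show ?thesis using L[of z] by (simp add: K_def)
  qed
  have Lhol: "L holomorphic_on ball 0 1"
    unfolding L_def[abs_def] using F by (intro holomorphic_intros holomorphic_blaschke_prod) auto
  have Lw: "L w = g w" if w: "w \<in> F" for w
  proof -
    have "L w = (\<Sum>v\<in>F. if v = w then g w else 0)"
      unfolding L_def
    proof (rule sum.cong)
      fix v assume v: "v \<in> F"
      show "g v / blaschke_prod (F - {v}) v * blaschke_prod (F - {v}) w = (if v = w then g w else 0)"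
        using v w F m(1) m(2)[OF w] by (auto simp: blaschke_prod_eq_0)
    qed auto
    then show ?thesis using w F by simp
  qed
  obtain h where h: "h holomorphic_on ball 0 1" "\<And>z. z \<in> ball 0 1 \<Longrightarrow> g z - L z = blaschke_prod F z * h z"
    using blaschke_prod_divides[OF F holomorphic_on_diff[OF g Lhol]] Lw by auto
  have half: "1 / 2 < (1::real)" by simp
  obtain r0 where r0: "0 < r0" "r0 < 1" "\<And>z. r0 \<le> norm z \<Longrightarrow> norm z \<le> 1 \<Longrightarrow> 1 / 2 < norm (blaschke_prod F z)"
    using blaschke_prod_near_boundary[OF F(2) half] by blast
  \<comment> \<open>Radius at least \<open>(1 + R) / 2\<close> leaves distance at least
    \<open>(1 - R) / 2\<close> to \<open>z\<close>; together with the factor 2 from dividing by the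
    product this gives the 4 in the bound.\<close>
  define r where "r = max r0 ((1 + R) / 2)"
  have r: "0 < r" "r < 1" "r0 \<le> r" "(1 + R) / 2 \<le> r" using r0 z by (auto simp: r_def)
  have cont_circle: "continuous_on A (\<lambda>\<theta>. f (of_real r * cis \<theta>))" if "f holomorphic_on ball 0 1" for f A
    using r by (intro continuous_on_circle holomorphic_on_imp_continuous_on that) auto
  have "integral {0..2*pi} (\<lambda>\<theta>. norm (h (of_real r * cis \<theta>)))
      \<le> integral {0..2*pi} (\<lambda>\<theta>. 2 * (norm (g (of_real r * cis \<theta>)) + K))"
  proof (rule integral_le)
    fix \<theta> :: real
    define \<zeta> where "\<zeta> = of_real r * cis \<theta>"
    have n\<zeta>: "norm \<zeta> = r" using r by (simp add: \<zeta>_def norm_mult)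
    have "1/2 * norm (h \<zeta>) \<le> norm (blaschke_prod F \<zeta>) * norm (h \<zeta>)"
      using r0(3)[of \<zeta>] n\<zeta> r by (intro mult_right_mono) auto
    also have "\<dots> = norm (g \<zeta> - L \<zeta>)"
      using h(2)[of \<zeta>] n\<zeta> r by (simp add: norm_mult)
    also have "\<dots> \<le> norm (g \<zeta>) + K"
      using norm_triangle_ineq4[of "g \<zeta>" "L \<zeta>"] LK[of \<zeta>] n\<zeta> r by simp
    finally show "norm (h (of_real r * cis \<theta>)) \<le> 2 * (norm (g (of_real r * cis \<theta>)) + K)"
      by (simp add: \<zeta>_def)
  qed (intro integrable_continuous_real continuous_intros cont_circle g h(1))+
  also have "\<dots> = 2 * integral {0..2*pi} (\<lambda>\<theta>. norm (g (of_real r * cis \<theta>))) + 2 * (2 * pi * K)"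
    by (subst integral_mult_right, subst integral_add)
      (auto intro!: integrable_continuous_real continuous_on_norm cont_circle g)
  also have "\<dots> \<le> 2 * pi * (2 * (1 + K))"
    using mean[OF r(1,2)] by (simp add: algebra_simps)
  finally have "norm (h z) \<le> 2 * (1 + K) / (r - norm z)"
    using r z by (intro norm_le_circle_mean h) auto
  also have "\<dots> \<le> 2 * (1 + K) / ((1 - R) / 2)"
    using r z K0 by (intro divide_left_mono mult_pos_pos) auto
  finally have hz: "norm (h z) \<le> 4 * (1 + K) / (1 - R)" by simp
  have "norm (g z) = norm (blaschke_prod F z * h z + L z)"
    using h(2)[of z] z by (simp add: algebra_simps)
  also have "\<dots> \<le> norm (blaschke_prod F z) * norm (h z) + norm (L z)"
    using norm_triangle_ineq by (metis norm_mult)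
  also have "\<dots> \<le> norm (blaschke_prod F z) * (4 * (1 + K) / (1 - R))
           + (\<Sum>w\<in>F. \<epsilon> / m * norm (blaschke_prod (F - {w}) z))"
    by (intro add_mono mult_left_mono hz L) auto
  finally show ?thesis by (simp add: K_def)
qed

section \<open>A Bernstein--Walsh estimate\<close>

text \<open>\<open>G\<close> below agrees in modulus with \<open>\<zeta> \<mapsto> blaschke_prod F (cnj \<zeta>)\<close> on the circle of radius \<open>R\<close>; its values at
  \<open>R\<^sup>2 / z\<close> are those of the product at \<open>z\<close> with the poles \<open>1 / cnj w\<close> divided out.\<close>
lemma norm_blaschke_prod_outside_le:
  fixes R S M :: real
  assumes R: "0 < R" "R \<le> norm z" "norm z < 1"
    and F: "F \<subseteq> cball 0 S" and S: "S < 1"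
    and M: "\<And>\<zeta>. norm \<zeta> \<le> R \<Longrightarrow> norm (blaschke_prod F \<zeta>) \<le> M"
  shows "norm (blaschke_prod F z) \<le> M * (1 + (norm z - R) * (1 / R + 2 / (R * (1 - S)))) ^ card F"
proof -
  define \<rho> where "\<rho> = norm z"
  define q where "q = 1 + (\<rho> - R) * (1 / R + 2 / (R * (1 - S)))"
  define G where "G \<zeta> = (\<Prod>w\<in>F. (of_real (R\<^sup>2) - w * \<zeta>) / (of_real R * (1 - w * \<zeta>)))" for \<zeta>
  have w1: "norm w < 1" if "w \<in> F" for w using F S that by auto
  have den: "1 - w * \<zeta> \<noteq> 0" if "w \<in> F" "norm \<zeta> < 1" for w \<zeta>
    using blaschke_denom_nonzero[of "cnj w" \<zeta>] w1[OF that(1)] that(2) by simp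
  have sphere: "norm (G \<zeta>) \<le> M" if \<zeta>: "norm \<zeta> = R" for \<zeta>
  proof -
    have "norm (G \<zeta>) = norm (blaschke_prod F (cnj \<zeta>))"
      unfolding G_def blaschke_prod_def prod_norm[symmetric]
    proof (rule prod.cong)
      fix w assume "w \<in> F"
      have "of_real (R\<^sup>2) - w * \<zeta> = \<zeta> * (cnj \<zeta> - w)"
        using \<zeta> complex_norm_square[of \<zeta>] by (simp add: algebra_simps)
      moreover have "norm (1 - w * \<zeta>) = norm (1 - cnj w * cnj \<zeta>)"
        using complex_mod_cnj[of "1 - w * \<zeta>"] by simp
      ultimately show "norm ((of_real (R\<^sup>2) - w * \<zeta>) / (of_real R * (1 - w * \<zeta>))) = norm (blaschke_factor w (cnj \<zeta>))"
        using \<zeta> R by (simp add: blaschke_factor_def norm_divide norm_mult)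
    qed simp
    then show ?thesis using M[of "cnj \<zeta>"] \<zeta> by simp
  qed
  have "norm (G (of_real (R\<^sup>2) / z)) \<le> M"
  proof (rule maximum_modulus_frontier[of G "cball 0 R"])
    have G: "G holomorphic_on ball 0 1"
      unfolding G_def[abs_def] using den R by (intro holomorphic_intros) auto
    show "G holomorphic_on interior (cball 0 R)"
      using R by (intro holomorphic_on_subset[OF G]) auto
    show "continuous_on (closure (cball 0 R)) G"
      using R by (intro continuous_on_subset[OF holomorphic_on_imp_continuous_on[OF G]]) auto
    show "of_real (R\<^sup>2) / z \<in> cball 0 R"
      using R by (simp add: norm_divide norm_mult power2_eq_square divide_le_eq)
  qed (use R sphere in auto)
  \<comment> \<open>For \<open>z \<noteq> w\<close> the quotient of corresponding factors is
    \<open>norm (z - w * R\<^sup>2) / (R * norm (1 - cnj w * z))\<close>. It equals 1 on the circle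
    of radius \<open>R\<close>, and \<open>q\<close> bounds its growth outside.\<close>
  moreover have "norm (blaschke_prod F z) \<le> norm (G (of_real (R\<^sup>2) / z)) * q ^ card F"
  proof -
    have "norm (blaschke_factor w z) \<le> norm ((of_real (R\<^sup>2) - w * (of_real (R\<^sup>2) / z)) / (of_real R * (1 - w * (of_real (R\<^sup>2) / z)))) * q"
      (is "_ \<le> norm ?g * q") if w: "w \<in> F" for w
    proof -
      define a where "a = norm (z - w)"
      define d where "d = norm (z - w * of_real (R\<^sup>2))"
      define N where "N = norm (1 - cnj w * z)"
      have N': "N = norm (1 - w * cnj z)"
        unfolding N_def by (subst complex_mod_cnj[symmetric]) simp
      have wS: "norm w \<le> S" using F w by auto
      have N: "1 - S \<le> N"
      proof -
        have "norm (cnj w * z) \<le> S * 1"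
          unfolding norm_mult complex_mod_cnj using wS R order_trans[OF norm_ge_zero wS]
          by (intro mult_mono) auto
        then show ?thesis
          unfolding N_def using norm_triangle_ineq2[of 1 "cnj w * z"] by simp
      qed
      have "norm w * R\<^sup>2 < R"
      proof -
        have "norm w * R\<^sup>2 \<le> 1 * R\<^sup>2" using w1[OF w] by (intro mult_right_mono) auto
        also have "\<dots> < R" using R by (simp add: power2_eq_square)
        finally show ?thesis .
      qed
      then have nz: "z - w * of_real (R\<^sup>2) \<noteq> 0"
        using R by (auto simp: norm_mult norm_power)
      have z0: "z \<noteq> 0" using R by auto
      have g: "?g = of_real R * (z - w) / (z - w * of_real (R\<^sup>2))"
      proof -
        have "of_real (R\<^sup>2) - w * (of_real (R\<^sup>2) / z) = of_real R * (of_real R * (z - w)) / z"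
          "1 - w * (of_real (R\<^sup>2) / z) = (z - w * of_real (R\<^sup>2)) / z"
          using z0 by (simp_all add: field_simps power2_eq_square)
        then show ?thesis using z0 R by simp
      qed
      have "norm (z - w * of_real (R\<^sup>2)) \<le> q * (R * N)"
      proof -
        \<comment> \<open>The first term has modulus \<open>\<rho> * N\<close>; the second vanishes
          on the circle of radius \<open>R\<close> and is of order \<open>\<rho> - R\<close> beyond
          it.\<close>
        have "z - w * of_real (R\<^sup>2) = z * (1 - w * cnj z) + w * of_real (\<rho>\<^sup>2 - R\<^sup>2)"
          using complex_norm_square[of z] by (simp add: \<rho>_def algebra_simps)
        then have "norm (z - w * of_real (R\<^sup>2)) \<le> norm (z * (1 - w * cnj z)) + norm (w * of_real (\<rho>\<^sup>2 - R\<^sup>2))"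
          by (metis norm_triangle_ineq)
        also have "\<dots> = \<rho> * N + norm w * \<bar>\<rho>\<^sup>2 - R\<^sup>2\<bar>"
          unfolding norm_mult norm_of_real N' \<rho>_def ..
        also have "norm w * \<bar>\<rho>\<^sup>2 - R\<^sup>2\<bar> \<le> 1 * (2 * (\<rho> - R))"
        proof (rule mult_mono)
          have "R\<^sup>2 \<le> \<rho>\<^sup>2" using R by (intro power_mono) (auto simp: \<rho>_def)
          then have "\<bar>\<rho>\<^sup>2 - R\<^sup>2\<bar> = (\<rho> + R) * (\<rho> - R)"
            by (simp add: power2_eq_square algebra_simps)
          also have "\<dots> \<le> 2 * (\<rho> - R)"
            using R by (intro mult_right_mono) (auto simp: \<rho>_def)
          finally show "\<bar>\<rho>\<^sup>2 - R\<^sup>2\<bar> \<le> 2 * (\<rho> - R)" .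
        qed (use w1[OF w] in auto)
        also have "1 * (2 * (\<rho> - R)) \<le> 2 * (\<rho> - R) * (N / (1 - S))"
        proof -
          have "1 \<le> N / (1 - S)" using N S by simp
          then have "2 * (\<rho> - R) * 1 \<le> 2 * (\<rho> - R) * (N / (1 - S))"
            using R by (intro mult_left_mono) (auto simp: \<rho>_def)
          then show ?thesis by simp
        qed
        also have "\<rho> * N + 2 * (\<rho> - R) * (N / (1 - S)) = q * (R * N)"
          using R S by (simp add: q_def field_simps)
        finally show ?thesis by simp
      qed
      then have ad: "a * d \<le> a * (q * (R * N))"
        unfolding a_def d_def by (intro mult_left_mono) auto
      have pos: "d > 0" "N > 0" using nz N S by (auto simp: d_def)
      have "norm (blaschke_factor w z) = a / N"
        by (simp add: blaschke_factor_def norm_divide N_def a_def)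
      also have "\<dots> \<le> R * a / d * q"
        using ad pos by (simp add: field_simps)
      also have "R * a / d = norm ?g"
        unfolding g a_def d_def using R by (simp add: norm_divide norm_mult)
      finally show ?thesis .
    qed
    then have "(\<Prod>w\<in>F. norm (blaschke_factor w z)) \<le> (\<Prod>w\<in>F. norm ((of_real (R\<^sup>2) - w * (of_real (R\<^sup>2) / z)) / (of_real R * (1 - w * (of_real (R\<^sup>2) / z)))) * q)"
      by (intro prod_mono) auto
    then show ?thesis
      by (simp only: blaschke_prod_def G_def prod.distrib prod_constant flip: prod_norm)
  qed
  moreover have "q \<ge> 0"
    using R S by (simp add: q_def \<rho>_def)
  ultimately have "norm (blaschke_prod F z) \<le> M * q ^ card F"
    by (meson order_trans mult_right_mono zero_le_power)
  then show ?thesis by (simp only: q_def \<rho>_def)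
qed

text \<open>Dividing by the factor of \<open>w\<close> is harmless away from \<open>w\<close>; if \<open>w\<close> is too close to the circle of radius \<open>R\<close>,
  work on the circle of radius \<open>R + \<kappa> / n\<close>, where the product has grown by a bounded factor only.\<close>
lemma blaschke_prod_remove_bound:
  fixes R S :: real
  assumes R: "0 < R" "R < 1" and S: "S < 1"
  obtains c :: real where "0 < c"
    "\<And>F w z M. finite F \<Longrightarrow> F \<subseteq> cball 0 S \<Longrightarrow> w \<in> F \<Longrightarrow>
       (\<And>\<zeta>. norm \<zeta> \<le> R \<Longrightarrow> norm (blaschke_prod F \<zeta>) \<le> M) \<Longrightarrow> norm z \<le> R \<Longrightarrow>
       norm (blaschke_prod (F - {w}) z) \<le> c * card F * M"
proof -
  define \<kappa> where "\<kappa> = (1 - R) / 2"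
  define c0 where "c0 = 1 / R + 2 / (R * (1 - S))"
  have \<kappa>: "\<kappa> > 0" "R + \<kappa> < 1" using R by (auto simp: \<kappa>_def field_simps)
  have c0: "c0 > 0" using R S by (auto simp: c0_def intro!: add_pos_pos)
  have bound: "norm (blaschke_prod (F - {w}) z) \<le> exp (\<kappa> * c0) * 4 / \<kappa> * card F * M"
    if F: "finite F" "F \<subseteq> cball 0 S" "w \<in> F"
      and M: "\<And>\<zeta>. norm \<zeta> \<le> R \<Longrightarrow> norm (blaschke_prod F \<zeta>) \<le> M" and z: "norm z \<le> R" for F w z M
  proof -
    define n where "n = card F"
    have n: "n \<ge> 1" using F by (auto simp: n_def Suc_le_eq card_gt_0_iff)
    have F1: "F \<subseteq> ball 0 1" using F S by auto
    have M0: "M \<ge> 0" using M[of 0] R by (auto intro: order_trans[OF norm_ge_zero])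
    \<comment> \<open>If \<open>norm w\<close> is within \<open>\<kappa> / (2 * n)\<close> of
      \<open>R\<close>, it is at least that far from \<open>R + \<kappa> / n\<close>. The step
      \<open>\<kappa> / n\<close> is small enough for the growth
      \<open>(1 + \<kappa> / n * c0) ^ n\<close> to stay below
      \<open>exp (\<kappa> * c0)\<close>.\<close>
    define \<rho> where "\<rho> = (if \<bar>norm w - R\<bar> \<ge> \<kappa> / (2 * n) then R else R + \<kappa> / n)"
    have \<kappa>n: "0 < \<kappa> / n" "\<kappa> / n \<le> \<kappa>" "\<kappa> / (2 * n) = (\<kappa> / n) / 2"
      using n \<kappa> by (auto simp: divide_le_eq mult_le_cancel_left1)
    have \<rho>: "R \<le> \<rho>" "\<rho> \<le> R + \<kappa> / n" "\<rho> < 1" "\<kappa> / (2 * n) \<le> \<bar>norm w - \<rho>\<bar>"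
      using \<kappa>n \<kappa> by (auto simp: \<rho>_def)
    show ?thesis
    proof (rule maximum_modulus_frontier[of "blaschke_prod (F - {w})" "cball 0 \<rho>"])
      have F1': "F - {w} \<subseteq> ball 0 1" using F1 by auto
      show "blaschke_prod (F - {w}) holomorphic_on interior (cball 0 \<rho>)"
        using \<rho> by (intro holomorphic_on_subset[OF holomorphic_blaschke_prod[OF F1']]) auto
      show "continuous_on (closure (cball 0 \<rho>)) (blaschke_prod (F - {w}))"
        using \<rho> by (intro continuous_on_subset[OF continuous_on_blaschke_prod[OF F1']]) auto
      show "z \<in> cball 0 \<rho>" using z \<rho> by simp
      fix \<zeta> :: complex
      assume "\<zeta> \<in> frontier (cball 0 \<rho>)"
      then have \<zeta>: "norm \<zeta> = \<rho>" using \<rho> R by simp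
      have "norm (blaschke_prod F \<zeta>) \<le> M * (1 + (\<rho> - R) * c0) ^ n"
        using norm_blaschke_prod_outside_le[of R \<zeta> F S M] R \<zeta> \<rho> F S M
        by (simp add: c0_def n_def)
      also have "(1 + (\<rho> - R) * c0) ^ n \<le> (1 + \<kappa> / n * c0) ^ n"
        using \<rho> c0 by (intro power_mono add_mono mult_right_mono) auto
      also have "\<dots> \<le> exp (\<kappa> / n * c0) ^ n"
        using \<kappa>n c0 by (intro power_mono exp_ge_add_one_self add_nonneg_nonneg mult_nonneg_nonneg) auto
      also have "\<dots> = exp (\<kappa> * c0)"
        using n by (simp flip: exp_of_nat_mult)
      finally have A: "norm (blaschke_prod F \<zeta>) \<le> M * exp (\<kappa> * c0)"
        using M0 by (simp add: mult_left_mono)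
      have B: "\<kappa> / (4 * n) \<le> norm (blaschke_factor w \<zeta>)"
      proof -
        have "norm (1 - cnj w * \<zeta>) \<le> norm (1::complex) + norm (cnj w * \<zeta>)" by (rule norm_triangle_ineq4)
        also have "norm (cnj w * \<zeta>) \<le> 1 * 1"
          unfolding norm_mult using F1 F(3) \<zeta> \<rho> by (intro mult_mono) auto
        finally have "norm (1 - cnj w * \<zeta>) \<le> 2" by simp
        moreover have "\<kappa> / (2 * n) \<le> norm (\<zeta> - w)"
          using \<rho>(4) norm_triangle_ineq3[of \<zeta> w] \<zeta> by simp
        moreover have "norm (1 - cnj w * \<zeta>) > 0"
          using blaschke_denom_nonzero[of w \<zeta>] F1 F(3) \<zeta> \<rho> by auto
        ultimately have "\<kappa> / (2 * n) / 2 \<le> norm (\<zeta> - w) / norm (1 - cnj w * \<zeta>)"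
          using \<kappa> by (intro frac_le) auto
        then show ?thesis by (simp add: blaschke_factor_def norm_divide)
      qed
      have "\<kappa> / (4 * n) * norm (blaschke_prod (F - {w}) \<zeta>) \<le> norm (blaschke_factor w \<zeta>) * norm (blaschke_prod (F - {w}) \<zeta>)"
        by (intro mult_right_mono B) auto
      also have "\<dots> = norm (blaschke_prod F \<zeta>)"
        using blaschke_prod_remove[OF F(1,3)] by (simp add: norm_mult)
      finally have "\<kappa> / (4 * n) * norm (blaschke_prod (F - {w}) \<zeta>) \<le> M * exp (\<kappa> * c0)"
        using A by simp
      then show "norm (blaschke_prod (F - {w}) \<zeta>) \<le> exp (\<kappa> * c0) * 4 / \<kappa> * card F * M"
        using \<kappa> n unfolding n_def[symmetric] by (simp add: field_simps)
    qed (use R \<rho> in auto)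
  qed
  show ?thesis
  proof (rule that)
    show "exp (\<kappa> * c0) * 4 / \<kappa> > 0" using \<kappa> by simp
  qed (rule bound)
qed

section \<open>Nearly optimal Fekete sets\<close>

text \<open>The pseudohyperbolic analogue of the squared Vandermonde determinant: every unordered
  pair of points is counted twice.\<close>

definition blaschke_energy :: "complex set \<Rightarrow> real" where
  "blaschke_energy F = (\<Prod>w\<in>F. norm (blaschke_prod (F - {w}) w))"

text \<open>The new point contributes its own product and, by symmetry of the distance, one factor
  at each old point; hence the square.\<close>

lemma blaschke_energy_insert:
  assumes "finite F" "z \<notin> F"
  shows "blaschke_energy (insert z F) = blaschke_energy F * (norm (blaschke_prod F z))\<^sup>2"
proof -
  have "(\<Prod>w\<in>F. norm (blaschke_prod (insert z F - {w}) w))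
      = (\<Prod>w\<in>F. norm (blaschke_factor w z) * norm (blaschke_prod (F - {w}) w))"
  proof (rule prod.cong)
    fix w assume "w \<in> F"
    then have "insert z F - {w} = insert z (F - {w})" using assms by auto
    then show "norm (blaschke_prod (insert z F - {w}) w) = norm (blaschke_factor w z) * norm (blaschke_prod (F - {w}) w)"
      using assms norm_blaschke_factor_commute[of z w] by (simp add: blaschke_prod_insert norm_mult)
  qed simp
  also have "\<dots> = norm (blaschke_prod F z) * blaschke_energy F"
    by (simp add: prod.distrib blaschke_energy_def blaschke_prod_def[of F] flip: prod_norm)
  finally show ?thesis
    using assms by (simp add: blaschke_energy_def power2_eq_square)
qed

lemma blaschke_energy_pos:
  assumes "finite F" "F \<subseteq> ball 0 1"
  shows "0 < blaschke_energy F"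
  unfolding blaschke_energy_def
proof (rule prod_pos)
  fix w assume "w \<in> F"
  then have "blaschke_prod (F - {w}) w \<noteq> 0"
    using assms by (intro blaschke_prod_nonzero) (auto intro: less_imp_le)
  then show "0 < norm (blaschke_prod (F - {w}) w)" by simp
qed

lemma blaschke_energy_le_1:
  assumes "F \<subseteq> ball 0 1"
  shows "blaschke_energy F \<le> 1"
  unfolding blaschke_energy_def
  using assms by (intro prod_le_1 conjI norm_blaschke_prod_le_1) (auto intro: less_imp_le)

lemma norm_blaschke_prod_power2_le:
  assumes "F \<subseteq> cball 0 S" "norm z \<le> S" "0 \<le> S" "S < 1"
  shows "(norm (blaschke_prod F z))\<^sup>2 \<le> (1 - (1 - S\<^sup>2)\<^sup>2 / 4) ^ card F"
proof -
  have "(\<Prod>w\<in>F. (norm (blaschke_factor w z))\<^sup>2) \<le> (\<Prod>w\<in>F. 1 - (1 - S\<^sup>2)\<^sup>2 / 4)"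
    using assms by (intro prod_mono) (auto intro!: norm_blaschke_factor_le)
  then show ?thesis
    by (simp add: blaschke_prod_def prod_power_distrib flip: prod_norm)
qed

text \<open>With \<open>s n\<close> the supremum of the energies of \<open>n\<close>-point subsets, \<open>n\<close> is the first index with
  \<open>2 s (n + 1) / s n \<le> \<epsilon>\<close>. Adding a point to \<open>F\<close> gives the upper bound on \<open>E\<close>, removing one the lower
  bound on \<open>F\<close>.\<close>
lemma near_fekete_set:
  fixes E :: "complex set" and S \<epsilon> :: real
  assumes E: "infinite E" "E \<subseteq> cball 0 S" and S: "0 \<le> S" "S < 1" and \<epsilon>: "0 < \<epsilon>" "\<epsilon> < 2"
  obtains F where "finite F" "F \<subseteq> E" "F \<noteq> {}"
    "\<And>z. z \<in> E \<Longrightarrow> (norm (blaschke_prod F z))\<^sup>2 \<le> \<epsilon>"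
    "\<And>w. w \<in> F \<Longrightarrow> \<epsilon> / 4 \<le> (norm (blaschke_prod (F - {w}) w))\<^sup>2"
    "\<epsilon> \<le> 2 * (1 - (1 - S\<^sup>2)\<^sup>2 / 4) ^ (card F - 1)"
proof -
  define \<sigma> where "\<sigma> = 1 - (1 - S\<^sup>2)\<^sup>2 / 4"
  have S2: "0 \<le> S\<^sup>2" "S\<^sup>2 < 1" using S by (auto simp: power_less_one_iff abs_square_less_1)
  then have "0 < (1 - S\<^sup>2)\<^sup>2" "(1 - S\<^sup>2)\<^sup>2 \<le> 1" by (auto intro: power_le_one)
  then have \<sigma>: "0 < \<sigma>" "\<sigma> < 1" by (auto simp: \<sigma>_def)
  have E1: "E \<subseteq> ball 0 1" using E S by auto
  define \<F> where "\<F> n = {F. F \<subseteq> E \<and> finite F \<and> card F = n}" for n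
  define s where "s n = (SUP F\<in>\<F> n. blaschke_energy F)" for n
  have ne: "\<F> n \<noteq> {}" for n
    using infinite_arbitrarily_large[OF E(1), of n] by (auto simp: \<F>_def)
  have bdd: "bdd_above (blaschke_energy ` \<F> n)" for n
    using E1 by (intro bdd_aboveI[of _ 1]) (auto simp: \<F>_def intro!: blaschke_energy_le_1)
  have upper: "blaschke_energy F \<le> s n" if "F \<in> \<F> n" for F n
    unfolding s_def by (intro cSUP_upper that bdd)
  have pos: "s n > 0" for n
  proof -
    obtain F where F: "F \<in> \<F> n" using ne by blast
    then have "0 < blaschke_energy F"
      using E1 by (intro blaschke_energy_pos) (auto simp: \<F>_def)
    then show ?thesis using upper[OF F] by simp
  qed
  have step: "blaschke_energy F * (norm (blaschke_prod F z))\<^sup>2 \<le> s (Suc n)" if "F \<in> \<F> n" "z \<in> E" for F z n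
  proof (cases "z \<in> F")
    case True
    then show ?thesis using that pos[of "Suc n"] by (simp add: \<F>_def blaschke_prod_eq_0)
  next
    case False
    then have "insert z F \<in> \<F> (Suc n)" using that by (auto simp: \<F>_def)
    then show ?thesis using upper[of "insert z F"] False that by (simp add: \<F>_def blaschke_energy_insert)
  qed
  have remove: "blaschke_energy F \<le> s n * (norm (blaschke_prod (F - {w}) w))\<^sup>2" if "F \<in> \<F> (Suc n)" "w \<in> F" for F w n
  proof -
    have "F - {w} \<in> \<F> n" using that by (auto simp: \<F>_def)
    then have "blaschke_energy (F - {w}) \<le> s n" by (rule upper)
    moreover have "blaschke_energy F = blaschke_energy (F - {w}) * (norm (blaschke_prod (F - {w}) w))\<^sup>2"
      using blaschke_energy_insert[of "F - {w}" w] that by (simp add: \<F>_def insert_absorb)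
    ultimately show ?thesis by (simp add: mult_right_mono)
  qed
  \<comment> \<open>Removing any point from an \<open>n + 1\<close>-point set leaves
    \<open>n\<close> factors, each with square at most \<open>\<sigma>\<close> at that point. Hence
    the ratios of successive suprema tend to 0 and the required index exists.\<close>
  have decay: "s (Suc n) \<le> s n * \<sigma> ^ n" for n
    unfolding s_def[of "Suc n"]
  proof (rule cSUP_least[OF ne])
    fix F assume F: "F \<in> \<F> (Suc n)"
    then obtain w where w: "w \<in> F" by (fastforce simp: \<F>_def)
    have "blaschke_energy F \<le> s n * (norm (blaschke_prod (F - {w}) w))\<^sup>2"
      by (rule remove[OF F w])
    also have "\<dots> \<le> s n * \<sigma> ^ card (F - {w})"
      unfolding \<sigma>_def using F w E S pos[of n]
      by (intro mult_left_mono norm_blaschke_prod_power2_le) (auto simp: \<F>_def)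
    finally show "blaschke_energy F \<le> s n * \<sigma> ^ n" using F w by (simp add: \<F>_def)
  qed
  have "\<exists>n. 2 * s (Suc n) \<le> \<epsilon> * s n"
  proof -
    obtain n where n: "\<sigma> ^ n < \<epsilon> / 2" using real_arch_pow_inv[of "\<epsilon> / 2" \<sigma>] \<sigma> \<epsilon> by auto
    have "2 * s (Suc n) \<le> 2 * (s n * \<sigma> ^ n)" using decay[of n] by simp
    also have "\<dots> \<le> 2 * (s n * (\<epsilon> / 2))" using n pos[of n] by (intro mult_left_mono) auto
    finally show ?thesis by (intro exI[of _ n]) (simp add: mult.commute)
  qed
  then obtain n where n: "2 * s (Suc n) \<le> \<epsilon> * s n" and least: "\<And>k. k < n \<Longrightarrow> \<not> 2 * s (Suc k) \<le> \<epsilon> * s k"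
    using exists_least_iff[of "\<lambda>n. 2 * s (Suc n) \<le> \<epsilon> * s n"] by blast
  \<comment> \<open>The empty set and singletons have energy 1, so the index 0 would force
    \<open>2 \<le> \<epsilon>\<close>.\<close>
  have "n \<noteq> 0"
  proof
    assume "n = 0"
    obtain x where "x \<in> E" using E(1) by fastforce
    then have "1 \<le> s 1" using upper[of "{x}" 1] by (simp add: \<F>_def blaschke_energy_def blaschke_prod_def)
    moreover have "s 0 \<le> 1"
      unfolding s_def by (rule cSUP_least[OF ne]) (auto simp: \<F>_def blaschke_energy_def)
    moreover have "\<epsilon> * s 0 \<le> \<epsilon> * 1" using \<epsilon> \<open>s 0 \<le> 1\<close> by (intro mult_left_mono) auto
    ultimately show False using n \<epsilon>(2) unfolding \<open>n = 0\<close> One_nat_def by linarith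
  qed
  then obtain k where k: "n = Suc k" using not0_implies_Suc by blast
  have gt: "\<epsilon> * s k < 2 * s n" using least[of k] k by simp
  \<comment> \<open>The supremum need not be attained, so \<open>F\<close> is chosen within a factor
    2 of it. The 2 in the choice of \<open>n\<close> compensates for this on \<open>E\<close>; on
    \<open>F\<close> both factors combine to \<open>\<epsilon> / 4\<close>.\<close>
  have "s n / 2 < s n" using pos[of n] by simp
  then obtain F where F: "F \<in> \<F> n" "s n / 2 < blaschke_energy F"
    unfolding s_def less_cSUP_iff[OF ne bdd] by blast
  show ?thesis
  proof (rule that[of F])
    show "finite F" "F \<subseteq> E" "F \<noteq> {}" using F k by (auto simp: \<F>_def)
    show "(norm (blaschke_prod F z))\<^sup>2 \<le> \<epsilon>" if "z \<in> E" for z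
    proof -
      have "s n / 2 * (norm (blaschke_prod F z))\<^sup>2 \<le> blaschke_energy F * (norm (blaschke_prod F z))\<^sup>2"
        using F(2) by (intro mult_right_mono) auto
      also have "\<dots> \<le> s (Suc n)" by (rule step[OF F(1) that])
      also have "\<dots> \<le> s n / 2 * \<epsilon>" using n by (simp add: mult.commute)
      finally show ?thesis using pos[of n] by simp
    qed
    show "\<epsilon> / 4 \<le> (norm (blaschke_prod (F - {w}) w))\<^sup>2" if "w \<in> F" for w
    proof -
      have "s k * (\<epsilon> / 4) \<le> blaschke_energy F" using gt F(2) by (simp add: mult.commute)
      also have "\<dots> \<le> s k * (norm (blaschke_prod (F - {w}) w))\<^sup>2"
        using F(1) that k by (intro remove) auto
      finally show ?thesis using pos[of k] by simp
    qed
    \<comment> \<open>Failure of the criterion at \<open>k = n - 1\<close>, combined with the decay,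
      bounds \<open>n\<close> by a multiple of \<open>log (1 / \<epsilon>)\<close> up to an additive
      constant.\<close>
    have "s k * \<epsilon> \<le> s k * (2 * \<sigma> ^ k)"
      using gt decay[of k] k by (simp add: mult.commute)
    then have "\<epsilon> \<le> 2 * \<sigma> ^ k" using pos[of k] by simp
    then show "\<epsilon> \<le> 2 * (1 - (1 - S\<^sup>2)\<^sup>2 / 4) ^ (card F - 1)"
      using F k by (simp add: \<F>_def \<sigma>_def)
  qed
qed

section \<open>Proof of the theorem\<close>

text \<open>Taking the \<open>k\<close>-th root of \<open>\<sigma>\<close> reduces to
  \<open>n * \<tau> ^ n\<close>, which Bernoulli's inequality for \<open>1 / \<tau>\<close>
  bounds.\<close>

lemma power_times_geometric_bounded:
  fixes \<sigma> :: real and k :: nat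
  assumes "0 < \<sigma>" "\<sigma> < 1" "0 < k"
  obtains D where "0 < D" "\<And>n. real n ^ k * \<sigma> ^ n \<le> D"
proof -
  define \<tau> where "\<tau> = root k \<sigma>"
  have \<tau>: "0 < \<tau>" "\<tau> < 1" "\<tau> ^ k = \<sigma>"
    using assms by (auto simp: \<tau>_def)
  define x where "x = 1 / \<tau> - 1"
  have x: "x > 0" using \<tau> by (simp add: x_def)
  have *: "real n * \<tau> ^ n \<le> 1 / x" for n
  proof -
    have "real n * x \<le> 1 + real n * x" by simp
    also have "\<dots> \<le> (1 + x) ^ n" using x by (intro Bernoulli_inequality) auto
    also have "\<dots> = 1 / \<tau> ^ n" by (simp add: x_def power_divide)
    finally show ?thesis using x \<tau> by (simp add: field_simps)
  qed
  show ?thesis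
  proof (rule that)
    show "0 < (1 / x) ^ k" using x by simp
    show "real n ^ k * \<sigma> ^ n \<le> (1 / x) ^ k" for n
    proof -
      have "real n ^ k * \<sigma> ^ n = (real n * \<tau> ^ n) ^ k"
        by (simp add: power_mult_distrib flip: \<tau>(3) power_mult) (simp add: mult.commute)
      also have "\<dots> \<le> (1 / x) ^ k" using \<tau> by (intro power_mono *) auto
      finally show ?thesis .
    qed
  qed
qed

lemma subset_cball_of_closure_subset_ball:
  fixes E :: "'a::euclidean_space set"
  assumes "closure E \<subseteq> ball 0 r" and "0 < r"
  obtains S where "0 \<le> S" "S < r" "E \<subseteq> cball 0 S"
proof (cases "E = {}")
  case True
  then show ?thesis using that[of 0] assms by simp
next
  case False
  have "bounded (closure E)" using assms bounded_ball bounded_subset by blast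
  then have "compact (closure E)" by (simp add: compact_eq_bounded_closed)
  then obtain x where x: "x \<in> closure E" "\<And>y. y \<in> closure E \<Longrightarrow> norm y \<le> norm x"
    using continuous_attains_sup[of "closure E" norm] False continuous_on_norm_id by auto
  show ?thesis
  proof (rule that[of "norm x"])
    show "norm x < r" using x(1) assms by auto
    show "E \<subseteq> cball 0 (norm x)" using x(2) closure_subset[of E] by auto
  qed simp
qed

theorem theorem1p3:
  fixes p :: ereal and R :: real
  assumes "1 \<le> p" and "0 < R" and "R < 1"
  shows "\<exists>C>0. \<forall>E :: complex set.
           E \<subseteq> ball 0 1 \<and> infinite E \<and> closure E \<subseteq> ball 0 1 \<longrightarrow>
           (\<exists>\<epsilon>0>0. \<forall>\<epsilon>. 0 < \<epsilon> \<and> \<epsilon> < \<epsilon>0 \<longrightarrow>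
              (\<exists>zs. zs \<noteq> [] \<and> set zs \<subseteq> closure E \<and>
                 (SUP z\<in>cball 0 R. norm (blaschke zs z)) \<le> C_const p E \<epsilon> R \<and>
                 C_const p E \<epsilon> R \<le> C * sqrt (SUP z\<in>cball 0 R. norm (blaschke zs z)) \<and>
                 (\<forall>z\<in>E. norm (blaschke zs z) \<le> \<epsilon>)))"
proof -
  \<comment> \<open>The first summand is \<open>4 * (1 + K) / (1 - R)\<close> with
    \<open>K = 1\<close>, from the quotient \<open>h\<close>; the 1 pays for the interpolant
    \<open>L\<close>.\<close>
  define C where "C = 8 / (1 - R) + 1"
  have C: "C > 0" using assms by (simp add: C_def add_pos_pos)
  have "\<exists>\<epsilon>0>0. \<forall>\<epsilon>. 0 < \<epsilon> \<and> \<epsilon> < \<epsilon>0 \<longrightarrow>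
              (\<exists>zs. zs \<noteq> [] \<and> set zs \<subseteq> closure E \<and>
                 (SUP z\<in>cball 0 R. norm (blaschke zs z)) \<le> C_const p E \<epsilon> R \<and>
                 C_const p E \<epsilon> R \<le> C * sqrt (SUP z\<in>cball 0 R. norm (blaschke zs z)) \<and>
                 (\<forall>z\<in>E. norm (blaschke zs z) \<le> \<epsilon>))"
    if E: "E \<subseteq> ball 0 1" "infinite E" "closure E \<subseteq> ball 0 1" for E :: "complex set"
  proof -
    obtain S where S: "0 \<le> S" "S < 1" "E \<subseteq> cball 0 S"
      using subset_cball_of_closure_subset_ball[OF E(3)] by auto
    define \<sigma> where "\<sigma> = 1 - (1 - S\<^sup>2)\<^sup>2 / 4"
    have "0 \<le> S\<^sup>2" "S\<^sup>2 < 1" using S by (auto simp: abs_square_less_1)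
    then have "0 < (1 - S\<^sup>2)\<^sup>2" "(1 - S\<^sup>2)\<^sup>2 \<le> 1" by (auto intro: power_le_one)
    then have \<sigma>: "0 < \<sigma>" "\<sigma> < 1" by (auto simp: \<sigma>_def)
    obtain D where D: "0 < D" "\<And>n. real n ^ 8 * \<sigma> ^ n \<le> D"
      using power_times_geometric_bounded[OF \<sigma>, of 8] by auto
    obtain c0 :: real where c0: "\<And>F w z M. finite F \<Longrightarrow> F \<subseteq> cball 0 S \<Longrightarrow> w \<in> F \<Longrightarrow>
       (\<And>\<zeta>. norm \<zeta> \<le> R \<Longrightarrow> norm (blaschke_prod F \<zeta>) \<le> M) \<Longrightarrow> norm z \<le> R \<Longrightarrow>
       norm (blaschke_prod (F - {w}) z) \<le> c0 * card F * M"
      using blaschke_prod_remove_bound[OF assms(2,3) S(2)] by metis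
    \<comment> \<open>Making \<open>c\<close> at least 1 ensures
      \<open>n \<le> c * n\<^sup>2\<close>, so that one smallness condition yields both that are
      needed.\<close>
    define c where "c = max 1 c0"
    have c: "c \<ge> 1" "c \<ge> c0" by (auto simp: c_def)
    \<comment> \<open>The second entry makes
      \<open>16 * c ^ 4 * (2 * D / \<sigma>) * \<epsilon>\<close> at most 1; the first ensures
      \<open>\<epsilon> < 2\<close> for the choice of \<open>F\<close>. The threshold depends on
      \<open>E\<close>, but \<open>C\<close> does not.\<close>
    define \<epsilon>0 where "\<epsilon>0 = min 1 (\<sigma> / (32 * c ^ 4 * D))"
    have \<epsilon>0: "\<epsilon>0 > 0" using \<sigma> c D by (simp add: \<epsilon>0_def)
    have "\<exists>zs. zs \<noteq> [] \<and> set zs \<subseteq> closure E \<and>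
                 (SUP z\<in>cball 0 R. norm (blaschke zs z)) \<le> C_const p E \<epsilon> R \<and>
                 C_const p E \<epsilon> R \<le> C * sqrt (SUP z\<in>cball 0 R. norm (blaschke zs z)) \<and>
                 (\<forall>z\<in>E. norm (blaschke zs z) \<le> \<epsilon>)"
      if \<epsilon>: "0 < \<epsilon>" "\<epsilon> < \<epsilon>0" for \<epsilon>
    proof -
      have \<epsilon>2: "\<epsilon> < 2" using \<epsilon> by (simp add: \<epsilon>0_def)
      obtain F where F: "finite F" "F \<subseteq> E" "F \<noteq> {}"
        and FE: "\<And>z. z \<in> E \<Longrightarrow> (norm (blaschke_prod F z))\<^sup>2 \<le> \<epsilon>"
        and Fm: "\<And>w. w \<in> F \<Longrightarrow> \<epsilon> / 4 \<le> (norm (blaschke_prod (F - {w}) w))\<^sup>2"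
        and Fn: "\<epsilon> \<le> 2 * (1 - (1 - S\<^sup>2)\<^sup>2 / 4) ^ (card F - 1)"
        using near_fekete_set[OF E(2) S(3,1,2) \<epsilon>(1) \<epsilon>2] by metis
      obtain ws where ws: "set ws = F" "distinct ws" using finite_distinct_list[OF F(1)] by blast
      define zs where "zs = ws @ ws"
      define B where "B = blaschke zs"
      have B: "B z = blaschke_prod F z * blaschke_prod F z" for z
        using ws by (simp add: B_def zs_def blaschke_append blaschke_conv_prod)
      have nB: "norm (B z) = (norm (blaschke_prod F z))\<^sup>2" for z
        by (simp add: B norm_mult power2_eq_square)
      have F1: "F \<subseteq> ball 0 1" using F E by auto
      define M where "M = sqrt (SUP z\<in>cball 0 R. norm (B z))"
      have M: "norm (blaschke_prod F z) \<le> M" if "norm z \<le> R" for z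
      proof -
        have "norm (B z) \<le> (SUP z\<in>cball 0 R. norm (B z))"
          using that assms(3) by (intro cSUP_upper bdd_aboveI[of _ 1])
            (auto simp: nB intro!: power_le_one norm_blaschke_prod_le_1[OF F1])
        then show ?thesis unfolding M_def nB by (rule real_le_rsqrt)
      qed
      have M0: "M \<ge> 0" using M[of 0] assms(2) by (auto intro: order_trans[OF norm_ge_zero])
      define n where "n = card F"
      have n: "n \<ge> 1" using F by (simp add: n_def Suc_le_eq card_gt_0_iff)
      define m where "m = sqrt \<epsilon> / 2"
      have m: "0 < m" "m\<^sup>2 = \<epsilon> / 4"
        using \<epsilon> by (simp_all add: m_def power_divide)
      have "\<epsilon> / m = 2 * (\<epsilon> / sqrt \<epsilon>)" by (simp add: m_def)
      then have \<epsilon>m: "\<epsilon> / m = 2 * sqrt \<epsilon>" using \<epsilon> by (simp only: real_div_sqrt less_imp_le)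
      have mle: "m \<le> norm (blaschke_prod (F - {w}) w)" if "w \<in> F" for w
        using Fm[OF that] unfolding m(2)[symmetric] by (rule power2_le_imp_le) simp
      \<comment> \<open>The fourth power contains \<open>n ^ 8 * \<epsilon>\<^sup>2\<close>. One
        factor \<open>\<epsilon>\<close> absorbs \<open>n ^ 8\<close> through
        \<open>\<epsilon> \<le> 2 * \<sigma> ^ (n - 1)\<close>, at the price of
        \<open>1 / \<sigma>\<close> for the shifted exponent; the other supplies the
        smallness.\<close>
      have small: "2 * c * (real n)\<^sup>2 * sqrt \<epsilon> \<le> 1"
      proof -
        have "(2 * c * (real n)\<^sup>2 * sqrt \<epsilon>) ^ 4 = 16 * c ^ 4 * (real n ^ 8 * \<epsilon>) * \<epsilon>"
        proof -
          have "sqrt \<epsilon> ^ 4 = (sqrt \<epsilon> ^ 2) ^ 2" by (simp flip: power_mult)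
          also have "\<dots> = \<epsilon> * \<epsilon>" using \<epsilon> by (simp add: power2_eq_square)
          finally show ?thesis by (simp add: power_mult_distrib flip: power_mult)
        qed
        also have "real n ^ 8 * \<epsilon> \<le> 2 * D / \<sigma>"
        proof -
          have "real n ^ 8 * \<epsilon> \<le> real n ^ 8 * (2 * \<sigma> ^ (n - 1))"
            using Fn by (intro mult_left_mono) (auto simp: n_def \<sigma>_def)
          also have "\<sigma> ^ (n - 1) = \<sigma> ^ n / \<sigma>"
            using n \<sigma> by (simp add: power_diff)
          also have "real n ^ 8 * (2 * (\<sigma> ^ n / \<sigma>)) = 2 * (real n ^ 8 * \<sigma> ^ n) / \<sigma>" by simp
          also have "\<dots> \<le> 2 * D / \<sigma>" using D(2)[of n] \<sigma> by (intro divide_right_mono) auto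
          finally show ?thesis .
        qed
        also have "16 * c ^ 4 * (2 * D / \<sigma>) * \<epsilon> \<le> 16 * c ^ 4 * (2 * D / \<sigma>) * (\<sigma> / (32 * c ^ 4 * D))"
          using \<epsilon> c D \<sigma> by (intro mult_left_mono) (auto simp: \<epsilon>0_def)
        also have "\<dots> = 1" using c D \<sigma> by (simp add: field_simps)
        finally have "(2 * c * (real n)\<^sup>2 * sqrt \<epsilon>) ^ 4 \<le> 1 ^ 4"
          using c \<epsilon> by (simp add: mult_left_mono mult_right_mono)
        then show ?thesis by (subst (asm) power_mono_iff) (use c \<epsilon> in auto)
      qed
      have small1: "real n * (\<epsilon> / m) \<le> 1"
      proof -
        have "1 * real n \<le> c * (real n)\<^sup>2"
          using n c by (intro mult_mono self_le_power) auto
        then have "2 * real n * sqrt \<epsilon> \<le> 2 * (c * (real n)\<^sup>2) * sqrt \<epsilon>"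
          using \<epsilon> by (intro mult_right_mono) auto
        then show ?thesis using small unfolding \<epsilon>m by (simp add: mult_ac)
      qed
      define \<G> where "\<G> = {g \<in> hardy_space p. hardy_norm p g \<le> 1 \<and> (\<forall>\<zeta>\<in>E. norm (g \<zeta>) \<le> \<epsilon>)}"
      have "B \<in> \<G>"
      proof -
        have hol: "B holomorphic_on ball 0 1"
          unfolding B[abs_def] using F1 by (intro holomorphic_intros holomorphic_blaschke_prod)
        have "hardy_norm p B \<le> 1"
          using F1 by (intro hardy_norm_le_one hol assms)
            (auto simp: nB intro!: power_le_one norm_blaschke_prod_le_1)
        then show ?thesis
          using hol FE by (auto simp: \<G>_def hardy_space_def nB intro: le_less_trans)
      qed
      have ne: "cball 0 R \<noteq> ({} :: complex set)" using assms by simp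
      have upper: "(SUP z\<in>cball 0 R. norm (g z)) \<le> C * M" if g: "g \<in> \<G>" for g
      proof (rule cSUP_least[OF ne])
        fix z :: complex
        assume "z \<in> cball 0 R"
        then have z: "norm z \<le> R" by simp
        have hol: "g holomorphic_on ball 0 1" and gnorm: "hardy_norm p g \<le> 1"
          using g by (auto simp: \<G>_def hardy_space_def)
        have "norm (g z) \<le> norm (blaschke_prod F z) * (4 * (1 + card F * (\<epsilon> / m)) / (1 - R))
           + (\<Sum>w\<in>F. \<epsilon> / m * norm (blaschke_prod (F - {w}) z))"
          using g F \<epsilon> assms z
          by (intro blaschke_interpolation_bound F F1 hol circle_mean_le[OF hol assms(1) gnorm] m mle)
            (auto simp: \<G>_def)
        also have "\<dots> \<le> M * (4 * (1 + 1) / (1 - R)) + (\<Sum>w\<in>F. \<epsilon> / m * (c * n * M))"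
        proof (intro add_mono mult_mono sum_mono divide_right_mono mult_left_mono)
          fix w assume w: "w \<in> F"
          have "norm (blaschke_prod (F - {w}) z) \<le> c0 * n * M"
            unfolding n_def using w S(3) F z by (intro c0 M) auto
          also have "\<dots> \<le> c * n * M" using c M0 by (intro mult_right_mono) auto
          finally show "norm (blaschke_prod (F - {w}) z) \<le> c * n * M" .
        qed (use M[OF z] M0 m \<epsilon> small1 assms n_def in auto)
        \<comment> \<open>One factor \<open>n\<close> counts the points of \<open>F\<close>, the
          other comes from the loss in omitting a zero.\<close>
        also have "(\<Sum>w\<in>F. \<epsilon> / m * (c * n * M)) = (2 * c * (real n)\<^sup>2 * sqrt \<epsilon>) * M"
          unfolding \<epsilon>m by (simp add: n_def power2_eq_square)
        also have "\<dots> \<le> 1 * M" using small M0 by (rule mult_right_mono)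
        finally show "norm (g z) \<le> C * M" by (simp add: C_def algebra_simps)
      qed
      \<comment> \<open>The bound for all competitors also makes their suprema bounded above, as the
        real \<open>SUP\<close> in \<open>C_const\<close> requires before the competitor
        \<open>B\<close> can bound it from below.\<close>
      have "(SUP z\<in>cball 0 R. norm (B z)) \<le> C_const p E \<epsilon> R"
        unfolding C_const_def \<G>_def[symmetric]
        using upper \<open>B \<in> \<G>\<close> by (intro cSUP_upper bdd_aboveI[of _ "C * M"]) auto
      moreover have "C_const p E \<epsilon> R \<le> C * M"
        unfolding C_const_def \<G>_def[symmetric] using \<open>B \<in> \<G>\<close> by (intro cSUP_least[OF _ upper]) auto
      moreover have "zs \<noteq> []" "set zs \<subseteq> closure E"
        using ws F closure_subset[of E] by (auto simp: zs_def)
      moreover have "\<forall>z\<in>E. norm (B z) \<le> \<epsilon>" using FE by (simp add: nB)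
      ultimately show ?thesis
        unfolding M_def B_def by blast
    qed
    with \<epsilon>0 show ?thesis by blast
  qed
  with C show ?thesis by blast
qed

end
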